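(* Let $G=\{\alpha_t : t\in\mathbb{N}\}$ be a countable subgroup of $\mathbb{T}=\mathbb{R}/\mathbb{Z}$. Then there exists a set $A\subseteq\mathbb{N}$ (regarded as an increasing sequence of positive integers) such that for all $\beta\in\mathbb{T}$: $$\beta\in G \;\Rightarrow\; \text{for every } r>0:\ \sum_{n\in A}\|n\beta\|^r<\infty,\qquad\qquad \beta\notin G\;\Rightarrow\;\limsup_{n\in A,\,n\to\infty}\|n\beta\|\ge 1/6.$$
   Context: $\mathbb{T}=\mathbb{R}/\mathbb{Z}$, and for $x\in\mathbb{T}$ (or $x\in\mathbb{R}$), $\|x\|$ denotes the distance from $x$ to the nearest integer. *)

theory Defs
  imports "HOL-Analysis.Analysis" "HOL-Library.Liminf_Limsup"
begin

definition dist_int :: "real \<Rightarrow> real" where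
  "dist_int x = \<bar>x - real_of_int (round x)\<bar>"

text \<open>A subgroup of the circle group R/Z, represented by its preimage in R:
  a subgroup of (R,+) containing the integers.\<close>
definition circle_subgroup :: "real set \<Rightarrow> bool" where
  "circle_subgroup G \<longleftrightarrow> \<int> \<subseteq> G \<and> (\<forall>x\<in>G. \<forall>y\<in>G. x - y \<in> G)"

end

theory Submission
  imports Defs
begin

text \<open>
  Enumerate \<open>G\<close> as \<open>\<alpha>\<^sub>0, \<alpha>\<^sub>1, \<dots>\<close>. For every \<open>t\<close> one finds an infinite set \<open>A\<^sub>t\<close> on which
  \<open>\<Sum> \<parallel>n \<alpha>\<^sub>i\<parallel>\<^sup>r\<close> is tiny for \<open>i < t\<close>, while only finitely many \<open>\<beta>\<close> modulo 1 satisfy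
  \<open>\<parallel>n \<beta>\<parallel> \<le> 1/6\<close> for all \<open>n \<in> A\<^sub>t\<close>, and these all lie in \<open>G\<close>. By compactness a finite part of
  \<open>A\<^sub>t\<close> confines such \<open>\<beta>\<close> to a small neighbourhood of this finite set \<open>Z\<^sub>t\<close>. As \<open>Z\<^sub>t\<close> is
  known before the radius is chosen, the radius can be taken below the separation of
  \<open>Z\<^sub>t \<union> Z\<^sub>t\<^sub>+\<^sub>1\<close>; a \<open>\<beta>\<close> that survives from some stage on is then a fixed element of the \<open>Z\<^sub>t\<close>.

  To build \<open>A\<^sub>t\<close>, take finitely many \<open>n\<^sub>j\<close> for which the vectors of signed fractional parts of
  \<open>n\<^sub>j \<alpha>\<close> are short and linearly dependent over the reals, although the corresponding lattice
  points are independent over the integers. Rounding a real relation gives an integer combination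
  that is at most half as long as one of the vectors it involves and can replace it. Multiples are
  built by binary addition chains, so the \<open>r\<close>-th powers of the norms sum up to a telescoping
  series. Along the chain the integers nearest to \<open>n \<beta>\<close> are determined by those of the \<open>n\<^sub>j\<close>, so
  that only finitely many \<open>\<beta>\<close> survive. The survivors outside \<open>G\<close> are removed one by one: for
  \<open>\<beta> \<notin> G\<close> a mean value argument yields \<open>n\<close> with all \<open>\<parallel>n \<alpha>\<^sub>i\<parallel>\<close> as small as desired and
  \<open>\<parallel>n \<beta>\<parallel> > 1/6\<close>.
\<close>

section \<open>Distance to the nearest integer\<close>

lemma dist_int_nonneg [simp]: "0 \<le> dist_int x"
  by (simp add: dist_int_def)

lemma dist_int_le_half: "dist_int x \<le> 1/2"
  using of_int_round_abs_le[of x] by (simp add: dist_int_def abs_minus_commute)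

lemma dist_int_le: "dist_int x \<le> \<bar>x - of_int m\<bar>"
  unfolding dist_int_def by (rule round_diff_minimal)

lemma dist_int_0 [simp]: "dist_int 0 = 0"
  by (simp add: dist_int_def)

lemma dist_int_add: "dist_int (x + y) \<le> dist_int x + dist_int y"
  using dist_int_le[of "x + y" "round x + round y"] by (simp add: dist_int_def)

lemma dist_int_minus [simp]: "dist_int (- x) = dist_int x"
proof (rule antisym)
  show "dist_int (- x) \<le> dist_int x" for x
    using dist_int_le[of "- x" "- round x"] by (simp add: dist_int_def)
  from this[of "- x"] show "dist_int x \<le> dist_int (- x)" by simp
qed

lemma dist_int_add_of_int [simp]: "dist_int (x + of_int m) = dist_int x"
proof (rule antisym)
  show "dist_int (x + of_int m) \<le> dist_int x" for x m
    using dist_int_le[of "x + of_int m" "round x + m"] by (simp add: dist_int_def)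
  from this[of "x + of_int m" "- m"] show "dist_int x \<le> dist_int (x + of_int m)" by simp
qed

lemma dist_int_lipschitz: "\<bar>dist_int x - dist_int y\<bar> \<le> \<bar>x - y\<bar>"
proof -
  have "dist_int x \<le> dist_int y + \<bar>x - y\<bar>" for x y
    using dist_int_le[of x "round y"] by (simp add: dist_int_def)
  from this[of x y] this[of y x] show ?thesis by linarith
qed

lemma continuous_on_dist_int: "continuous_on S dist_int"
proof (rule continuous_onI)
  fix x e :: real assume "0 < e"
  then show "\<exists>d>0. \<forall>x'\<in>S. dist x' x < d \<longrightarrow> dist (dist_int x') (dist_int x) \<le> e"
    by (intro exI[of _ e])
      (auto simp: dist_real_def intro: order_trans[OF dist_int_lipschitz] less_imp_le)
qed

lemma dist_int_mult_abs: "dist_int (of_int \<bar>n\<bar> * x) = dist_int (of_int n * x)"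
  by (cases "n \<ge> 0") auto

text \<open>The defect of additivity is an integer made up of three rounding errors of at most 1/6
  each, so its absolute value is below 1. This is how the threshold 1/6 controls addition
  chains.\<close>

lemma round_add_of_dist_int_le:
  assumes "dist_int x \<le> 1/6" "dist_int y \<le> 1/6" "dist_int (x + y) \<le> 1/6"
  shows "round (x + y) = round x + round y"
proof -
  have "\<bar>real_of_int (round (x + y) - (round x + round y))\<bar> < 1"
    using assms unfolding dist_int_def of_int_diff of_int_add by linarith
  then show ?thesis by linarith
qed

text \<open>Halving lowers the r-th power by a fixed proportion, so a cost proportional to
  \<open>a powr r\<close> can be charged to the decrease. This is what makes costs
  telescope.\<close>

lemma powr_halving_gap:
  fixes a b r :: real
  assumes "0 \<le> b" "b \<le> a / 2" "0 < r"
  shows "(1 - 2 powr (-r)) * a powr r \<le> a powr r - b powr r"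
proof -
  have "b powr r \<le> (a / 2) powr r" using assms by (intro powr_mono2) auto
  also have "\<dots> = 2 powr (-r) * a powr r"
    using assms by (simp add: powr_divide powr_minus field_simps)
  finally show ?thesis by (simp add: algebra_simps)
qed

section \<open>Addition chains\<close>

text \<open>Rounding is additive on triples \<open>u, v, u + v\<close> along which all values are close to
  integers. Hence on an addition chain the rounded values are determined by those on its
  starting set.\<close>

definition add_chain :: "int set \<Rightarrow> int set \<Rightarrow> bool" where
  "add_chain S A \<longleftrightarrow>
    (\<forall>D :: int \<Rightarrow> int. (\<forall>u\<in>A. \<forall>v\<in>A. u + v \<in> A \<longrightarrow> D (u + v) = D u + D v) \<longrightarrow>
      (\<forall>s\<in>S. D s = 0) \<longrightarrow> (\<forall>n\<in>A. D n = 0))"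

lemma add_chainI:
  assumes "\<And>D :: int \<Rightarrow> int. (\<And>u v. u \<in> A \<Longrightarrow> v \<in> A \<Longrightarrow> u + v \<in> A \<Longrightarrow> D (u + v) = D u + D v) \<Longrightarrow>
      (\<And>s. s \<in> S \<Longrightarrow> D s = 0) \<Longrightarrow> (\<And>n. n \<in> A \<Longrightarrow> D n = 0)"
  shows "add_chain S A"
  using assms unfolding add_chain_def by blast

lemma add_chainD:
  assumes "add_chain S A"
    and "\<And>u v. u \<in> A \<Longrightarrow> v \<in> A \<Longrightarrow> u + v \<in> A \<Longrightarrow> D (u + v) = D u + (D v :: int)"
    and "\<And>s. s \<in> S \<Longrightarrow> D s = 0" and "n \<in> A"
  shows "D n = 0"
  using assms unfolding add_chain_def by blast

lemma add_chain_union: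
  assumes "add_chain S A" "add_chain T B" "T \<subseteq> A"
  shows "add_chain S (A \<union> B)"
proof (rule add_chainI)
  fix D :: "int \<Rightarrow> int" and n
  assume *: "\<And>u v. u \<in> A \<union> B \<Longrightarrow> v \<in> A \<union> B \<Longrightarrow> u + v \<in> A \<union> B \<Longrightarrow> D (u + v) = D u + D v"
    "\<And>s. s \<in> S \<Longrightarrow> D s = 0" and n: "n \<in> A \<union> B"
  have A: "D m = 0" if "m \<in> A" for m
    by (rule add_chainD[OF assms(1)]) (use * that in auto)
  have "D m = 0" if "m \<in> B" for m
    by (rule add_chainD[OF assms(2)]) (use * that A assms(3) in auto)
  with A n show "D n = 0" by auto
qed

section \<open>Seminorms on the integers and the cost of chains\<close>

text \<open>An abstraction of \<open>bohr_norm\<close>. It is only a seminorm: a nonzero integer has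
  value 0 when it multiplies all frequencies into the integers.\<close>

locale int_seminorm =
  fixes h :: "int \<Rightarrow> real"
  assumes h_nonneg [simp]: "0 \<le> h n"
    and h_add: "h (m + n) \<le> h m + h n"
    and h_minus [simp]: "h (- n) = h n"
    and h_0 [simp]: "h 0 = 0"
begin

lemma h_mult: "h (c * n) \<le> \<bar>of_int c\<bar> * h n"
proof -
  have "h (int k * n) \<le> of_nat k * h n" for k
  proof (induction k)
    case (Suc k)
    have "h (int (Suc k) * n) = h (int k * n + n)" by (simp add: algebra_simps)
    also have "\<dots> \<le> of_nat (Suc k) * h n" using h_add[of "int k * n" n] Suc by (simp add: algebra_simps)
    finally show ?case .
  qed simp
  from this[of "nat \<bar>c\<bar>"] have "h (\<bar>c\<bar> * n) \<le> \<bar>of_int c\<bar> * h n" by simp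
  moreover have "h (\<bar>c\<bar> * n) = h (c * n)" by (cases "c \<ge> 0") auto
  ultimately show ?thesis by simp
qed

definition cost :: "real \<Rightarrow> int set \<Rightarrow> real" where
  "cost r E = (\<Sum>u\<in>E. h u powr r)"

lemma cost_union_le:
  assumes "finite A" "finite B" shows "cost r (A \<union> B) \<le> cost r A + cost r B"
  using sum.union_inter[OF assms, of "\<lambda>u. h u powr r"] sum_nonneg[of "A \<inter> B" "\<lambda>u. h u powr r"]
  by (simp add: cost_def)

lemma cost_mono: "finite B \<Longrightarrow> A \<subseteq> B \<Longrightarrow> cost r A \<le> cost r B"
  unfolding cost_def by (rule sum_mono2) auto

lemma cost_insert_le:
  assumes "finite A" shows "cost r (insert a A) \<le> h a powr r + cost r A"
  using cost_union_le[of "{a}" A r] assms by (simp add: cost_def)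

text \<open>Binary expansion: \<open>c\<close> is reached from \<open>c div 2\<close> by one
  doubling and at most one addition of \<open>n\<close>. The seminorm bound halves at each level, so
  the r-th powers are dominated by a geometric series.\<close>

lemma nat_multiple_chain:
  assumes r: "0 < r" and c: "1 \<le> c"
  shows "\<exists>E. finite E \<and> n \<in> E \<and> int c * n \<in> E \<and> add_chain {n} E \<and>
    cost r E \<le> 2 / (1 - 2 powr (-r)) * (of_nat c * h n) powr r"
  using c
proof (induction c rule: less_induct)
  case (less c)
  \<comment> \<open>\<open>K\<close> solves \<open>K = 2 + K * 2 powr (-r)\<close>: each level adds
    at most two elements of cost at most \<open>(of_nat c * h n) powr r\<close>, and the bound for
    the level below is smaller by the factor \<open>2 powr (-r)\<close>.\<close>
  define K where "K = 2 / (1 - 2 powr (-r))"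
  have gap: "0 < 1 - 2 powr (-r)" "1 - 2 powr (-r) \<le> 1"
    using r by (simp_all add: powr_minus_divide)
  have K: "K \<ge> 2" "K * (1 - 2 powr (-r)) = 2"
  proof -
    define g where "g = 1 - 2 powr (-r)"
    have "0 < g" "g \<le> 1" "K = 2 / g" using gap by (simp_all add: g_def K_def)
    moreover from this have "2 \<le> 2 / g" by (subst pos_le_divide_eq) auto
    ultimately show "K \<ge> 2" "K * (1 - 2 powr (-r)) = 2" unfolding g_def[symmetric] by auto
  qed
  show ?case
  proof (cases "c = 1")
    case True
    have "cost r {n} \<le> K * (h n powr r)"
      using mult_right_mono[of 1 K "h n powr r"] K by (simp add: cost_def)
    then show ?thesis using True
      by (intro exI[of _ "{n}"]) (auto simp: add_chain_def K_def)
  next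
    case False
    define u where "u = c div 2"
    have u: "u \<ge> 1" "u < c" using less.prems False by (auto simp: u_def)
    from less.IH[OF u(2,1)] obtain E where E: "finite E" "n \<in> E" "int u * n \<in> E" "add_chain {n} E"
      "cost r E \<le> K * (of_nat u * h n) powr r" by (auto simp: K_def)
    \<comment> \<open>For even \<open>c\<close> the two inserted elements coincide; for odd
      \<open>c\<close> the second is the first plus \<open>n\<close>.\<close>
    define E' where "E' = insert (int (2 * u) * n) (insert (int c * n) E)"
    have cases: "c = 2 * u \<or> c = 2 * u + 1" by (auto simp: u_def)
    have "add_chain {n} E'"
    proof (rule add_chainI)
      fix D :: "int \<Rightarrow> int" and m
      assume *: "\<And>u v. u \<in> E' \<Longrightarrow> v \<in> E' \<Longrightarrow> u + v \<in> E' \<Longrightarrow> D (u + v) = D u + D v"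
        "\<And>s. s \<in> {n} \<Longrightarrow> D s = 0" and m: "m \<in> E'"
      have DE: "D m = 0" if "m \<in> E" for m
        by (rule add_chainD[OF E(4)]) (use * that in \<open>auto simp: E'_def\<close>)
      have "int u * n + int u * n = int (2 * u) * n" by (simp add: algebra_simps)
      with *(1)[of "int u * n" "int u * n"] DE[OF E(3)] E(3) have D2: "D (int (2 * u) * n) = 0"
        by (simp add: E'_def)
      have "int (2 * u) * n + n = int (2 * u + 1) * n" by (simp add: algebra_simps)
      with *(1)[of "int (2 * u) * n" n] D2 *(2)[of n] E(2) cases have "D (int c * n) = 0"
        by (auto simp: E'_def)
      with D2 DE m show "D m = 0" by (auto simp: E'_def)
    qed
    moreover have "cost r E' \<le> K * (of_nat c * h n) powr r"
    proof -
      define p where "p = (of_nat c * h n) powr r"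
      have "cost r E' \<le> h (int (2 * u) * n) powr r + (h (int c * n) powr r + cost r E)"
        unfolding E'_def using E(1)
        by (intro order_trans[OF cost_insert_le] add_left_mono cost_insert_le) auto
      also have "\<dots> \<le> p + (p + K * (2 powr (-r) * p))"
      proof (intro add_mono)
        have "h (int (2 * u) * n) \<le> real (2 * u) * h n" using h_mult[of "int (2 * u)" n] by simp
        also have "\<dots> \<le> real c * h n" using cases by (intro mult_right_mono) auto
        finally show "h (int (2 * u) * n) powr r \<le> p"
          unfolding p_def using r by (intro powr_mono2) auto
        show "h (int c * n) powr r \<le> p"
          unfolding p_def using r h_mult[of "int c" n] by (intro powr_mono2) auto
        have "real u * h n \<le> (real c * h n) / 2" using cases h_nonneg[of n] by (auto simp: algebra_simps)
        from powr_halving_gap[OF _ this r] have "(real u * h n) powr r \<le> 2 powr (-r) * p"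
          by (simp add: p_def algebra_simps)
        with E(5) K show "cost r E \<le> K * (2 powr (-r) * p)"
          by (meson order_trans mult_left_mono zero_le_numeral)
      qed
      also have "\<dots> = 2 * p + K * p - K * (1 - 2 powr (-r)) * p" by (simp add: algebra_simps)
      also have "\<dots> = K * p" unfolding K(2) by simp
      finally show ?thesis by (simp add: p_def)
    qed
    ultimately show ?thesis using E by (intro exI[of _ E']) (auto simp: E'_def K_def)
  qed
qed

lemma multiple_chain:
  assumes r: "0 < r"
  shows "\<exists>E. finite E \<and> c * n \<in> E \<and> add_chain {n} (insert n E) \<and>
    cost r E \<le> (2 / (1 - 2 powr (-r)) + 1) * (\<bar>of_int c\<bar> * h n) powr r"
proof (cases "c = 0")
  case True
  have "D 0 = 0" if "\<And>u v. u \<in> {0,n} \<Longrightarrow> v \<in> {0,n} \<Longrightarrow> u + v \<in> {0,n} \<Longrightarrow> D (u + v) = D u + D v"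
    for D :: "int \<Rightarrow> int"
    using that[of 0 0] by auto
  then have "add_chain {n} {n, 0}" by (intro add_chainI) (auto simp: insert_commute)
  then show ?thesis using True r
    by (intro exI[of _ "{0}"]) (auto simp: cost_def)
next
  case False
  then have "nat \<bar>c\<bar> \<ge> 1" by linarith
  from nat_multiple_chain[OF r this, of n] obtain E where E: "finite E" "n \<in> E" "\<bar>c\<bar> * n \<in> E"
      "add_chain {n} E" "cost r E \<le> 2 / (1 - 2 powr (-r)) * (\<bar>of_int c\<bar> * h n) powr r"
    by auto
  define E' where "E' = insert 0 (insert (c * n) E)"
  have "add_chain {n} E'"
  proof (rule add_chainI)
    fix D :: "int \<Rightarrow> int" and m
    assume *: "\<And>u v. u \<in> E' \<Longrightarrow> v \<in> E' \<Longrightarrow> u + v \<in> E' \<Longrightarrow> D (u + v) = D u + D v"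
      "\<And>s. s \<in> {n} \<Longrightarrow> D s = 0" and m: "m \<in> E'"
    have DE: "D m = 0" if "m \<in> E" for m
      by (rule add_chainD[OF E(4)]) (use * that in \<open>auto simp: E'_def\<close>)
    \<comment> \<open>Zero joins the chain so that negative multiples can be reached:
      \<open>\<bar>c\<bar> * n + c * n = 0\<close> turns additivity into
      \<open>D (c * n) = 0\<close>.\<close>
    have D0: "D 0 = 0" using *(1)[of 0 0] by (auto simp: E'_def)
    have "D (c * n) = 0"
    proof (cases "c \<ge> 0")
      case True
      then show ?thesis using DE[OF E(3)] by simp
    next
      case False
      then show ?thesis using *(1)[of "\<bar>c\<bar> * n" "c * n"] DE[OF E(3)] E(3) D0 by (simp add: E'_def)
    qed
    with D0 DE m show "D m = 0" by (auto simp: E'_def)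
  qed
  moreover have "insert n E' = E'" using E by (auto simp: E'_def)
  moreover have "cost r E' \<le> (2 / (1 - 2 powr (-r)) + 1) * (\<bar>of_int c\<bar> * h n) powr r"
  proof -
    have "cost r E' \<le> h 0 powr r + (h (c * n) powr r + cost r E)"
      unfolding E'_def using E(1)
      by (intro order_trans[OF cost_insert_le] add_left_mono cost_insert_le) auto
    also have "h (c * n) powr r \<le> (\<bar>of_int c\<bar> * h n) powr r"
      using r h_mult[of c n] by (intro powr_mono2) auto
    finally show ?thesis using E(5) r by (simp add: algebra_simps)
  qed
  ultimately show ?thesis using E(1) by (intro exI[of _ E']) (auto simp: E'_def)
qed

text \<open>The multiples are reached separately and added up one at a time. Every partial sum has
  seminorm at most \<open>M * b\<close>, which accounts for the summand
  \<open>of_nat M powr r\<close>.\<close>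

lemma combination_chain:
  fixes c \<nu> :: "nat \<Rightarrow> int"
  assumes r: "0 < r" and "finite J" and "card J \<le> M"
    and "\<And>j. j \<in> J \<Longrightarrow> \<bar>of_int (c j)\<bar> * h (\<nu> j) \<le> b" and b: "0 \<le> b"
  shows "\<exists>E. finite E \<and> (\<Sum>j\<in>J. c j * \<nu> j) \<in> E \<and> add_chain (\<nu> ` J) (\<nu> ` J \<union> E) \<and>
    cost r E \<le> of_nat (card J) * ((2 / (1 - 2 powr (-r)) + 1 + of_nat M powr r) * b powr r)"
  using assms(2-4)
proof (induction J rule: finite_induct)
  case empty
  have "add_chain {} {0}" by (intro add_chainI) force
  then show ?case using r by (intro exI[of _ "{0}"]) (auto simp: cost_def)
next
  case (insert p J)
  define K where "K = 2 / (1 - 2 powr (-r)) + 1"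
  have gap: "0 < 1 - 2 powr (-r)" using r by (simp_all add: powr_minus_divide)
  have K: "K \<ge> 0" using gap by (simp add: K_def)
  define s where "s = (\<Sum>j\<in>J. c j * \<nu> j)"
  from insert.IH insert.prems insert.hyps obtain E where E: "finite E" "s \<in> E"
    "add_chain (\<nu> ` J) (\<nu> ` J \<union> E)" "cost r E \<le> of_nat (card J) * ((K + of_nat M powr r) * b powr r)"
    by (auto simp: s_def K_def)
  from multiple_chain[OF r, of "c p" "\<nu> p"] obtain E' where E': "finite E'" "c p * \<nu> p \<in> E'"
    "add_chain {\<nu> p} (insert (\<nu> p) E')" "cost r E' \<le> K * (\<bar>of_int (c p)\<bar> * h (\<nu> p)) powr r"
    unfolding K_def by auto
  have "K * (\<bar>of_int (c p)\<bar> * h (\<nu> p)) powr r \<le> K * b powr r"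
    using r insert.prems(2)[of p] K by (intro mult_left_mono powr_mono2) auto
  with E'(4) have cE': "cost r E' \<le> K * b powr r" by simp
  define F where "F = insert (s + c p * \<nu> p) (E \<union> E')"
  have "add_chain (\<nu> ` insert p J) (\<nu> ` insert p J \<union> F)" (is "add_chain _ ?B")
  proof (rule add_chainI)
    fix D :: "int \<Rightarrow> int" and m
    assume *: "\<And>u v. u \<in> ?B \<Longrightarrow> v \<in> ?B \<Longrightarrow> u + v \<in> ?B \<Longrightarrow> D (u + v) = D u + D v"
      "\<And>s. s \<in> \<nu> ` insert p J \<Longrightarrow> D s = 0" and m: "m \<in> ?B"
    have D1: "D m = 0" if "m \<in> \<nu> ` J \<union> E" for m
      by (rule add_chainD[OF E(3)]) (use * that in \<open>auto simp: F_def\<close>)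
    have D2: "D m = 0" if "m \<in> insert (\<nu> p) E'" for m
      by (rule add_chainD[OF E'(3)]) (use * that in \<open>auto simp: F_def\<close>)
    have "D (s + c p * \<nu> p) = D s + D (c p * \<nu> p)"
      using E(2) E'(2) by (intro *(1)) (auto simp: F_def)
    then have "D (s + c p * \<nu> p) = 0" using D1[of s] D2[of "c p * \<nu> p"] E(2) E'(2) by simp
    with D1 D2 m show "D m = 0" by (auto simp: F_def)
  qed
  moreover have "cost r F \<le> of_nat (card (insert p J)) * ((K + of_nat M powr r) * b powr r)"
  proof -
    have "h (\<Sum>j\<in>insert p J. c j * \<nu> j) \<le> (\<Sum>j\<in>insert p J. h (c j * \<nu> j))"
      using insert.hyps(1)
    proof (induction rule: finite_induct[OF finite.insertI[OF insert.hyps(1), of p]])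
      case (2 x F)
      then show ?case using h_add[of "c x * \<nu> x" "\<Sum>j\<in>F. c j * \<nu> j"] by simp
    qed simp
    also have "\<dots> \<le> (\<Sum>j\<in>insert p J. b)"
      using insert.prems(2) h_mult by (intro sum_mono) (meson order_trans)
    also have "\<dots> = of_nat (card (insert p J)) * b" by simp
    also have "\<dots> \<le> of_nat M * b" using insert.prems(1) b by (intro mult_right_mono) auto
    finally have "h (s + c p * \<nu> p) \<le> of_nat M * b"
      using insert.hyps by (simp add: s_def add.commute)
    then have "h (s + c p * \<nu> p) powr r \<le> (of_nat M * b) powr r" using r by (intro powr_mono2) auto
    also have "\<dots> = of_nat M powr r * b powr r" using b by (simp add: powr_mult)
    finally have 1: "h (s + c p * \<nu> p) powr r \<le> of_nat M powr r * b powr r" .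
    have "cost r F \<le> h (s + c p * \<nu> p) powr r + (cost r E + cost r E')"
      unfolding F_def using E(1) E'(1)
      by (intro order_trans[OF cost_insert_le] add_left_mono cost_union_le) auto
    with 1 E(4) cE' insert.hyps show ?thesis by (simp add: algebra_simps)
  qed
  ultimately show ?case using E(1) E'(1) insert.hyps
    by (intro exI[of _ F]) (auto simp: F_def s_def K_def add.commute)
qed

end

section \<open>Linear dependence of real vectors\<close>

definition lin_dep :: "nat \<Rightarrow> nat set \<Rightarrow> (nat \<Rightarrow> nat \<Rightarrow> real) \<Rightarrow> bool" where
  "lin_dep t J e \<longleftrightarrow> (\<exists>x. (\<exists>j\<in>J. x j \<noteq> 0) \<and> (\<forall>l<t. (\<Sum>j\<in>J. x j * e j l) = 0))"

text \<open>Gaussian elimination: a pivot \<open>p\<close> clears coordinate \<open>t\<close> from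
  the other vectors, so that one vector and one coordinate drop out.\<close>

lemma lin_dep_if_card_gt:
  assumes "finite J" "t < card J"
  shows "lin_dep t J e"
  using assms
proof (induction t arbitrary: J e)
  case 0
  then obtain j where "j \<in> J" by (metis card.empty ex_in_conv less_numeral_extra(3))
  then show ?case by (auto simp: lin_dep_def intro!: exI[of _ "\<lambda>_. 1"])
next
  case (Suc t J e)
  show ?case
  proof (cases "\<forall>j\<in>J. e j t = 0")
    case True
    from Suc.IH[of J e] Suc.prems have "lin_dep t J e" by simp
    then obtain x where "\<exists>j\<in>J. x j \<noteq> 0" "\<forall>l<t. (\<Sum>j\<in>J. x j * e j l) = 0"
      by (auto simp: lin_dep_def)
    then show ?thesis using True unfolding lin_dep_def less_Suc_eq by (intro exI[of _ x]) auto
  next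
    case False
    then obtain p where p: "p \<in> J" "e p t \<noteq> 0" by auto
    define e' where "e' j l = e j l - e j t / e p t * e p l" for j l
    have "finite (J - {p})" "t < card (J - {p})" using Suc.prems p by auto
    from Suc.IH[OF this, of e'] obtain x where x: "\<exists>j\<in>J - {p}. x j \<noteq> 0"
      "\<And>l. l < t \<Longrightarrow> (\<Sum>j\<in>J - {p}. x j * e' j l) = 0"
      by (auto simp: lin_dep_def)
    \<comment> \<open>The coefficient of the pivot turns the relation for \<open>e'\<close> into one
      for \<open>e\<close>; in coordinate \<open>t\<close> it holds because \<open>e'\<close>
      vanishes there.\<close>
    define y where "y = x(p := - (\<Sum>j\<in>J - {p}. x j * e j t) / e p t)"
    have y: "(\<Sum>j\<in>J. y j * e j l) = (\<Sum>j\<in>J - {p}. x j * e' j l)" for l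
    proof -
      have "(\<Sum>j\<in>J. y j * e j l) = y p * e p l + (\<Sum>j\<in>J - {p}. y j * e j l)"
        using Suc.prems(1) p by (simp add: sum.remove)
      also have "(\<Sum>j\<in>J - {p}. y j * e j l) = (\<Sum>j\<in>J - {p}. x j * e j l)"
        by (intro sum.cong) (auto simp: y_def)
      also have "y p * e p l = - (\<Sum>j\<in>J - {p}. x j * (e j t / e p t * e p l))"
        by (simp add: y_def sum_distrib_right sum_divide_distrib mult.assoc)
      finally show ?thesis by (simp add: e'_def algebra_simps sum_subtractf)
    qed
    have "(\<Sum>j\<in>J. y j * e j l) = 0" if "l < Suc t" for l
      using that x(2) p(2) unfolding y less_Suc_eq by (auto simp: e'_def)
    moreover have "\<exists>j\<in>J. y j \<noteq> 0" using x(1) by (auto simp: y_def)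
    ultimately show ?thesis unfolding lin_dep_def by (intro exI[of _ y]) auto
  qed
qed

text \<open>The dual functionals are extended one vector at a time. Later they express the
  coefficients of a vector relation through the coefficient of one additional vector.\<close>

lemma dual_basis_if_not_lin_dep:
  assumes "finite J" "\<not> lin_dep t J e"
  shows "\<exists>a :: nat \<Rightarrow> nat \<Rightarrow> real. \<forall>i\<in>J. \<forall>j\<in>J. (\<Sum>l<t. a j l * e i l) = (if i = j then 1 else 0)"
  using assms
proof (induction J rule: finite_induct)
  case (insert p J)
  have "\<not> lin_dep t J e"
  proof
    assume "lin_dep t J e"
    then obtain x where x: "\<exists>j\<in>J. x j \<noteq> 0" "\<forall>l<t. (\<Sum>j\<in>J. x j * e j l) = 0"
      by (auto simp: lin_dep_def)
    have "(\<Sum>j\<in>insert p J. (x(p := 0)) j * e j l) = (\<Sum>j\<in>J. x j * e j l)" for l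
      using insert.hyps by (auto intro!: sum.cong)
    moreover have "\<exists>j\<in>insert p J. (x(p := 0)) j \<noteq> 0" using x(1) insert.hyps by fastforce
    ultimately have "lin_dep t (insert p J) e"
      unfolding lin_dep_def using x(2) by (intro exI[of _ "x(p := 0)"]) simp
    with insert.prems show False ..
  qed
  with insert.IH obtain a where a: "\<And>i j. i \<in> J \<Longrightarrow> j \<in> J \<Longrightarrow> (\<Sum>l<t. a j l * e i l) = (if i = j then 1 else 0)"
    by metis
  define dl where "dl j z = (\<Sum>l<t. a j l * z l)" for j and z :: "nat \<Rightarrow> real"
  have dle: "dl j (e i) = (if i = j then 1 else 0)" if "i \<in> J" "j \<in> J" for i j
    using a that by (simp add: dl_def)
  \<comment> \<open>What remains of \<open>e p\<close> after subtracting its expansion in the old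
    vectors is nonzero, since otherwise there would be a linear relation.\<close>
  have "\<exists>l<t. e p l - (\<Sum>j\<in>J. dl j (e p) * e j l) \<noteq> 0"
  proof (rule ccontr)
    assume *: "\<not> ?thesis"
    define x where "x j = (if j = p then 1 else - dl j (e p))" for j
    have "(\<Sum>j\<in>insert p J. x j * e j l) = e p l - (\<Sum>j\<in>J. dl j (e p) * e j l)" for l
    proof -
      have "(\<Sum>j\<in>J. x j * e j l) = (\<Sum>j\<in>J. - (dl j (e p) * e j l))"
        using insert.hyps by (intro sum.cong) (auto simp: x_def)
      then show ?thesis using insert.hyps by (simp add: x_def sum_negf)
    qed
    with * have "lin_dep t (insert p J) e"
      unfolding lin_dep_def by (intro exI[of _ x]) (auto simp: x_def)
    with insert.prems show False ..
  qed
  then obtain q where q: "q < t" "e p q - (\<Sum>j\<in>J. dl j (e p) * e j q) \<noteq> 0" by blast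
  define d where "d = e p q - (\<Sum>j\<in>J. dl j (e p) * e j q)"
  \<comment> \<open>Coordinate \<open>q\<close> of that remainder, as a functional normalised at
    \<open>e p\<close>; it kills all old vectors. Subtracting multiples of it makes the old
    functionals vanish at \<open>e p\<close>.\<close>
  define b where "b l = ((if l = q then 1 else 0) - (\<Sum>j\<in>J. a j l * e j q)) / d" for l
  have b: "(\<Sum>l<t. b l * z l) = (z q - (\<Sum>j\<in>J. dl j z * e j q)) / d" for z
  proof -
    have "(\<Sum>l<t. b l * z l) = (\<Sum>l<t. (if l = q then z l else 0) - (\<Sum>j\<in>J. a j l * e j q) * z l) / d"
      unfolding sum_divide_distrib by (intro sum.cong) (auto simp: b_def algebra_simps)
    also have "(\<Sum>l<t. (if l = q then z l else 0) - (\<Sum>j\<in>J. a j l * e j q) * z l) =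
       z q - (\<Sum>l<t. \<Sum>j\<in>J. a j l * e j q * z l)"
      using q(1) by (simp add: sum_subtractf sum_distrib_right)
    also have "(\<Sum>l<t. \<Sum>j\<in>J. a j l * e j q * z l) = (\<Sum>j\<in>J. dl j z * e j q)"
      unfolding dl_def sum_distrib_right by (subst sum.swap) (simp add: mult_ac)
    finally show ?thesis .
  qed
  have bp: "(\<Sum>l<t. b l * e p l) = 1" using q by (simp add: b d_def)
  have bi: "(\<Sum>l<t. b l * e i l) = 0" if "i \<in> J" for i
  proof -
    have "(\<Sum>j\<in>J. dl j (e i) * e j q) = (\<Sum>j\<in>J. if j = i then e j q else 0)"
      using dle that by (intro sum.cong) auto
    then show ?thesis using that insert.hyps by (simp add: b)
  qed
  define a' where "a' j l = (if j = p then b l else a j l - dl j (e p) * b l)" for j l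
  have a': "(\<Sum>l<t. a' j l * z l) =
      (if j = p then \<Sum>l<t. b l * z l else dl j z - dl j (e p) * (\<Sum>l<t. b l * z l))" for j z
    unfolding a'_def dl_def[of j z]
    by (simp add: sum_subtractf left_diff_distrib sum_distrib_left mult.assoc)
  have "(\<Sum>l<t. a' j l * e i l) = (if i = j then 1 else 0)"
    if "i \<in> insert p J" "j \<in> insert p J" for i j
    unfolding a' using that insert.hyps(2) bp bi dle by auto
  then show ?case by blast
qed simp

section \<open>Approximate integer relations from real ones\<close>

text \<open>Maximise \<open>y j\<close> damped by one factor \<open>\<eta>\<close> for each strictly
  longer vector. A longer vector carries at least one factor less, so at the maximum its
  \<open>y\<close> must be smaller by a factor \<open>\<eta>\<close>. The damping involves at most
  \<open>card J\<close> factors, whence the comparison with all other indices.\<close>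

lemma dominant_index:
  fixes N y :: "nat \<Rightarrow> real" and \<eta> :: real
  assumes "finite J" "j\<^sub>0 \<in> J" "0 < y j\<^sub>0" "0 < \<eta>" "\<eta> \<le> 1"
  obtains i where "i \<in> J" "0 < y i" "\<And>j. j \<in> J \<Longrightarrow> \<eta> ^ card J * y j \<le> y i"
    "\<And>j. j \<in> J \<Longrightarrow> N i < N j \<Longrightarrow> y j \<le> \<eta> * y i"
proof -
  define \<rho> where "\<rho> j = card {l\<in>J. N l > N j}" for j
  define z where "z j = y j * \<eta> ^ \<rho> j" for j
  have "J \<noteq> {}" using assms by auto
  have "\<exists>i\<in>J. z i = Max (z ` J)" using Max_in[of "z ` J"] assms(1) \<open>J \<noteq> {}\<close> by fastforce
  then obtain i where i: "i \<in> J" "z i = Max (z ` J)" by blast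
  have zi: "z j \<le> z i" if "j \<in> J" for j using that assms(1) i by simp
  have "0 < z j\<^sub>0" using assms by (simp add: z_def)
  with zi[OF assms(2)] have "0 < z i" by linarith
  then have yi: "0 < y i" using assms(4) by (simp add: z_def zero_less_mult_iff)
  show ?thesis
  proof
    fix j assume j: "j \<in> J"
    show "\<eta> ^ card J * y j \<le> y i"
    proof (cases "y j \<ge> 0")
      case True
      have "\<rho> j \<le> card J" unfolding \<rho>_def using assms(1) by (intro card_mono) auto
      then have "\<eta> ^ card J * y j \<le> \<eta> ^ \<rho> j * y j"
        using True assms by (intro mult_right_mono power_decreasing) auto
      also have "\<dots> \<le> y i * \<eta> ^ \<rho> i" using zi[OF j] by (simp add: z_def mult.commute)
      also have "\<dots> \<le> y i * 1" using yi assms by (intro mult_left_mono power_le_one) auto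
      finally show ?thesis by simp
    next
      case False
      then show ?thesis using yi assms(4) by (smt (verit) mult_pos_neg zero_less_power)
    qed
    assume ij: "N i < N j"
    have "{l\<in>J. N l > N j} \<subset> {l\<in>J. N l > N i}" using ij j by auto
    then have "\<rho> j < \<rho> i" unfolding \<rho>_def using assms(1) by (intro psubset_card_mono) auto
    then have "\<eta> ^ \<rho> i \<le> \<eta> ^ Suc (\<rho> j)" using assms by (intro power_decreasing) auto
    then have "y i * \<eta> ^ \<rho> i \<le> y i * (\<eta> * \<eta> ^ \<rho> j)" using yi by simp
    with zi[OF j] have "y j * \<eta> ^ \<rho> j \<le> (\<eta> * y i) * \<eta> ^ \<rho> j" by (simp add: z_def mult_ac)
    then show "y j \<le> \<eta> * y i" using assms(4) by (simp add: mult_le_cancel_right)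
  qed (use i yi in auto)
qed

text \<open>A real relation is turned into an approximate integer relation in which the leading vector
  has a nonzero coefficient and strictly longer vectors do not occur. Rounding is harmless on
  shorter vectors, and the choice of a dominant index makes the contribution of the longer vectors
  negligible, uniformly in all vectors.\<close>

lemma integer_halving_relation:
  obtains C where "1 \<le> C" and
    "\<And>J t e. finite J \<Longrightarrow> card J \<le> M \<Longrightarrow> lin_dep t J e \<Longrightarrow>
       (\<And>j. j \<in> J \<Longrightarrow> 0 < (\<Sum>l<t. \<bar>e j l\<bar>)) \<Longrightarrow>
       \<exists>i c. i \<in> J \<and> c i \<noteq> 0 \<and>
         (\<forall>j\<in>J. \<bar>real_of_int (c j)\<bar> * (\<Sum>l<t. \<bar>e j l\<bar>) \<le> C * (\<Sum>l<t. \<bar>e i l\<bar>)) \<and>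
         (\<Sum>l<t. \<bar>\<Sum>j\<in>J. real_of_int (c j) * e j l\<bar>) \<le> (\<Sum>l<t. \<bar>e i l\<bar>) / 2"
proof -
  \<comment> \<open>Dirichlet approximation gives a multiplier up to \<open>Q\<close> with errors
    below \<open>1 / q\<close>. The value of \<open>\<eta>\<close> keeps a discarded longer vector,
    even multiplied by \<open>Q\<close>, within \<open>1 / q\<close> of the leading length; at most
    \<open>M\<close> such errors add up to no more than half of it. \<open>C\<close> bounds the
    resulting coefficients.\<close>
  define q where "q = 4 * M + 1"
  define Q where "Q = q ^ M"
  define \<eta> :: real where "\<eta> = 1 / (real (4 * M + 1) * real Q)"
  define C where "C = real Q / \<eta> ^ M + real Q + 1"
  have q: "q > 0" "Q \<ge> 1" by (simp_all add: q_def Q_def)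
  have \<eta>: "0 < \<eta>" "\<eta> \<le> 1"
    using q mult_mono[of 1 "real (4*M+1)" 1 "real Q"] by (auto simp: \<eta>_def field_simps)
  have "real Q / \<eta> ^ M \<ge> 0" using \<eta> by simp
  then have C1: "C \<ge> 1" by (simp add: C_def)
  show ?thesis
  proof (rule that[OF C1])
    fix J :: "nat set" and t :: nat and e :: "nat \<Rightarrow> nat \<Rightarrow> real"
    assume J: "finite J" "card J \<le> M" and dep: "lin_dep t J e"
      and pos: "\<And>j. j \<in> J \<Longrightarrow> 0 < (\<Sum>l<t. \<bar>e j l\<bar>)"
    define N where "N j = (\<Sum>l<t. \<bar>e j l\<bar>)" for j
    have N0: "0 \<le> N j" for j by (simp add: N_def sum_nonneg)
    from dep obtain x' j\<^sub>0 where x': "j\<^sub>0 \<in> J" "x' j\<^sub>0 \<noteq> 0" "\<And>l. l < t \<Longrightarrow> (\<Sum>j\<in>J. x' j * e j l) = 0"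
      by (auto simp: lin_dep_def)
    define y where "y j = \<bar>x' j\<bar> * N j" for j
    have "0 < y j\<^sub>0" using x' pos by (simp add: y_def N_def)
    with J x'(1) \<eta> obtain i where i: "i \<in> J" "0 < y i" "\<And>j. j \<in> J \<Longrightarrow> \<eta> ^ card J * y j \<le> y i"
      "\<And>j. j \<in> J \<Longrightarrow> N i < N j \<Longrightarrow> y j \<le> \<eta> * y i"
      by (metis dominant_index)
    \<comment> \<open>Normalised to \<open>x i = 1\<close>, so that the multiplier \<open>k\<close>
      itself is the coefficient at \<open>i\<close>: it is nonzero and free of rounding
      error.\<close>
    define x where "x j = x' j / x' i" for j
    have xi': "x' i \<noteq> 0" using i(2) by (auto simp: y_def)
    have xi: "x i = 1" using xi' by (simp add: x_def)
    have xN: "\<bar>x j\<bar> * N j = y j / \<bar>x' i\<bar>" for j by (simp add: x_def y_def)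
    have Ni: "N i = y i / \<bar>x' i\<bar>" using xN[of i] xi by simp
    have rel: "(\<Sum>j\<in>J. x j * e j l) = 0" if "l < t" for l
      using x'(3)[OF that] by (simp add: x_def flip: sum_divide_distrib)
    have small: "\<bar>x j\<bar> * N j \<le> N i / \<eta> ^ M" if "j \<in> J" for j
    proof -
      have "\<eta> ^ M * y j \<le> \<eta> ^ card J * y j"
        using J \<eta> by (intro mult_right_mono power_decreasing) (auto simp: y_def N0)
      also have "\<dots> \<le> y i" by (rule i(3)[OF that])
      finally have "\<eta> ^ M * (y j / \<bar>x' i\<bar>) \<le> y i / \<bar>x' i\<bar>" by (simp add: divide_right_mono)
      then show ?thesis using \<eta> unfolding xN Ni
        by (subst pos_le_divide_eq) (simp_all add: mult.commute)
    qed
    have tiny: "\<bar>x j\<bar> * N j \<le> \<eta> * N i" if "j \<in> J" "N i < N j" for j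
      using i(4)[OF that] unfolding xN Ni by (simp add: divide_right_mono)
    obtain f where f: "bij_betw f {..<card J} J" 
      using J(1) by (metis ex_bij_betw_nat_finite atLeast0LessThan)
    obtain k p where kp: "0 < k" "k \<le> int (q ^ card J)"
      "\<And>i. i < card J \<Longrightarrow> \<bar>of_int k * x (f i) - of_int (p i)\<bar> < 1 / q"
      using Dirichlet_approx_simult[OF q(1), of "card J" "\<lambda>i. x (f i)"] by metis
    have kQ: "real_of_int k \<le> real Q"
    proof -
      have "q ^ card J \<le> Q" unfolding Q_def using J q by (intro power_increasing) auto
      with kp(2) show ?thesis by linarith
    qed
    define g where "g j = p (inv_into {..<card J} f j)" for j
    have g: "\<bar>of_int k * x j - of_int (g j)\<bar> < 1 / q" if "j \<in> J" for j
      using kp(3)[of "inv_into {..<card J} f j"] f that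
      by (metis bij_betw_inv_into_right bij_betw_def g_def inv_into_into lessThan_iff)
    define c where "c j = (if j = i then k else if N j \<le> N i then g j else 0)" for j
    have "\<bar>real_of_int (c j)\<bar> * N j \<le> C * N i" if "j \<in> J" for j
    proof -
      consider "j = i" | "j \<noteq> i" "N j \<le> N i" | "j \<noteq> i" "N i < N j" by linarith
      then show ?thesis
      proof cases
        case 1
        have "real_of_int k \<le> C" using kQ \<open>real Q / \<eta> ^ M \<ge> 0\<close> by (simp add: C_def)
        then show ?thesis using 1 kp(1) N0 by (simp add: c_def mult_right_mono)
      next
        case 2
        have "1 / real q \<le> 1" using q by simp
        with g[OF that] have "\<bar>real_of_int (g j)\<bar> \<le> \<bar>real_of_int k * x j\<bar> + 1" by linarith
        also have "\<bar>real_of_int k * x j\<bar> \<le> real Q * \<bar>x j\<bar>"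
          using kp(1) kQ by (simp add: abs_mult mult_right_mono)
        finally have "\<bar>real_of_int (g j)\<bar> * N j \<le> (real Q * \<bar>x j\<bar> + 1) * N j"
          using N0 by (simp add: mult_right_mono)
        also have "\<dots> \<le> real Q * (\<bar>x j\<bar> * N j) + N i" using 2 by (simp add: algebra_simps)
        also have "\<dots> \<le> real Q * (N i / \<eta> ^ M) + N i"
          by (intro add_right_mono mult_left_mono small[OF that]) simp
        also have "\<dots> \<le> C * N i" using N0[of i] by (simp add: C_def algebra_simps)
        finally show ?thesis using 2 by (simp add: c_def)
      next
        case 3
        then show ?thesis using C1 N0 by (simp add: c_def)
      qed
    qed
    moreover have "(\<Sum>l<t. \<bar>\<Sum>j\<in>J. real_of_int (c j) * e j l\<bar>) \<le> N i / 2"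
    proof -
      \<comment> \<open>Subtracting \<open>k\<close> times the exact relation leaves only the
        rounding errors as coefficients.\<close>
      have *: "(\<Sum>j\<in>J. real_of_int (c j) * e j l) = (\<Sum>j\<in>J. (real_of_int (c j) - k * x j) * e j l)" if "l < t" for l
        using rel[OF that] by (simp add: algebra_simps sum_subtractf flip: sum_distrib_left)
      have "(\<Sum>l<t. \<bar>\<Sum>j\<in>J. real_of_int (c j) * e j l\<bar>)
          \<le> (\<Sum>l<t. \<Sum>j\<in>J. \<bar>real_of_int (c j) - k * x j\<bar> * \<bar>e j l\<bar>)"
        using * by (intro sum_mono) (auto simp: abs_mult[symmetric] intro!: sum_abs)
      also have "\<dots> = (\<Sum>j\<in>J. \<bar>real_of_int (c j) - k * x j\<bar> * N j)"
        by (subst sum.swap) (simp add: N_def sum_distrib_left)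
      also have "\<dots> \<le> (\<Sum>j\<in>J. N i / real q)"
      proof (rule sum_mono)
        fix j assume j: "j \<in> J"
        consider "j = i" | "j \<noteq> i" "N j \<le> N i" | "j \<noteq> i" "N i < N j" by linarith
        then show "\<bar>real_of_int (c j) - k * x j\<bar> * N j \<le> N i / real q"
        proof cases
          case 1
          then show ?thesis using N0 by (simp add: c_def xi)
        next
          case 2
          have "\<bar>real_of_int (g j) - k * x j\<bar> * N j \<le> 1 / real q * N i"
            using g[OF j] 2 N0 by (intro mult_mono) auto
          then show ?thesis using 2 by (simp add: c_def)
        next
          case 3
          have "\<bar>real_of_int k * x j\<bar> * N j = k * (\<bar>x j\<bar> * N j)" using kp(1) by (simp add: abs_mult)
          also have "\<dots> \<le> real Q * (\<eta> * N i)"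
            using tiny[OF j 3(2)] kQ kp(1) N0[of j] by (intro mult_mono[of "real_of_int k"]) auto
          also have "\<dots> = N i / real q" using q by (simp add: \<eta>_def q_def)
          finally show ?thesis using 3 by (simp add: c_def)
        qed
      qed
      also have "\<dots> = real (card J) * N i / real q" by simp
      also have "\<dots> \<le> N i / 2"
      proof -
        have "real (card J) * 2 \<le> real q" using J by (simp add: q_def)
        then have "real (card J) * 2 * N i \<le> real q * N i" using N0 by (rule mult_right_mono)
        then show ?thesis using q by (simp add: field_simps)
      qed
      finally show ?thesis .
    qed
    moreover have "c i \<noteq> 0" using kp(1) by (simp add: c_def)
    ultimately show "\<exists>i c. i \<in> J \<and> c i \<noteq> 0 \<and>
         (\<forall>j\<in>J. \<bar>real_of_int (c j)\<bar> * (\<Sum>l<t. \<bar>e j l\<bar>) \<le> C * (\<Sum>l<t. \<bar>e i l\<bar>)) \<and>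
         (\<Sum>l<t. \<bar>\<Sum>j\<in>J. real_of_int (c j) * e j l\<bar>) \<le> (\<Sum>l<t. \<bar>e i l\<bar>) / 2"
      using i(1) unfolding N_def by blast
  qed
qed

section \<open>Sparse chains in Bohr sets\<close>

definition bohr_vec :: "(nat \<Rightarrow> real) \<Rightarrow> int \<Rightarrow> nat \<Rightarrow> real" where
  "bohr_vec \<alpha> n l = of_int n * \<alpha> l - of_int (round (of_int n * \<alpha> l))"

definition bohr_norm :: "(nat \<Rightarrow> real) \<Rightarrow> nat \<Rightarrow> int \<Rightarrow> real" where
  "bohr_norm \<alpha> t n = (\<Sum>l<t. dist_int (of_int n * \<alpha> l))"

lemma bohr_norm_eq: "bohr_norm \<alpha> t n = (\<Sum>l<t. \<bar>bohr_vec \<alpha> n l\<bar>)"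
  by (simp add: bohr_norm_def bohr_vec_def dist_int_def)

lemma abs_bohr_vec_le: "\<bar>bohr_vec \<alpha> n l\<bar> \<le> 1"
  using dist_int_le_half[of "of_int n * \<alpha> l"] by (simp add: bohr_vec_def dist_int_def)

lemma bohr_vec_0 [simp]: "bohr_vec \<alpha> 0 l = 0"
  by (simp add: bohr_vec_def)

lemma int_seminorm_bohr_norm: "int_seminorm (bohr_norm \<alpha> t)"
proof
  fix m n
  show "bohr_norm \<alpha> t (m + n) \<le> bohr_norm \<alpha> t m + bohr_norm \<alpha> t n"
    unfolding bohr_norm_def sum.distrib[symmetric]
    by (intro sum_mono) (simp add: distrib_right dist_int_add)
qed (auto simp: bohr_norm_def intro: sum_nonneg)

text \<open>Residue vectors are additive up to integers, and a combination of length below 1/2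
  leaves no room for a nonzero integer shift.\<close>

lemma bohr_vec_combination:
  assumes "finite J" "(\<Sum>l<t. \<bar>\<Sum>j\<in>J. real_of_int (c j) * bohr_vec \<alpha> (\<nu> j) l\<bar>) < 1/2" "l < t"
  shows "bohr_vec \<alpha> (\<Sum>j\<in>J. c j * \<nu> j) l = (\<Sum>j\<in>J. real_of_int (c j) * bohr_vec \<alpha> (\<nu> j) l)"
proof -
  define z where "z = (\<Sum>j\<in>J. c j * round (of_int (\<nu> j) * \<alpha> l))"
  have eq: "of_int (\<Sum>j\<in>J. c j * \<nu> j) * \<alpha> l - of_int z = (\<Sum>j\<in>J. real_of_int (c j) * bohr_vec \<alpha> (\<nu> j) l)"
    by (simp add: z_def bohr_vec_def algebra_simps sum_subtractf sum_distrib_left sum_distrib_right)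
  have "\<bar>\<Sum>j\<in>J. real_of_int (c j) * bohr_vec \<alpha> (\<nu> j) l\<bar> < 1/2"
    using assms(2,3) member_le_sum[of l "{..<t}" "\<lambda>l. \<bar>\<Sum>j\<in>J. real_of_int (c j) * bohr_vec \<alpha> (\<nu> j) l\<bar>"]
    by simp
  then have "round (of_int (\<Sum>j\<in>J. c j * \<nu> j) * \<alpha> l) = z"
    unfolding eq[symmetric] by (rule round_unique')
  then show ?thesis using eq by (simp add: bohr_vec_def)
qed

text \<open>Linear independence over the integers of the points \<open>(n, p)\<close> of \<open>\<int> \<times> \<int>\<^sup>t\<close>, where \<open>p\<close>
  is the integer point nearest to \<open>n \<cdot> \<alpha>\<close>.\<close>

definition lattice_indep :: "(nat \<Rightarrow> real) \<Rightarrow> nat \<Rightarrow> nat set \<Rightarrow> (nat \<Rightarrow> int) \<Rightarrow> bool" where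
  "lattice_indep \<alpha> t J \<nu> \<longleftrightarrow> (\<forall>c :: nat \<Rightarrow> int. (\<Sum>j\<in>J. c j * \<nu> j) = 0 \<longrightarrow>
     (\<forall>l<t. (\<Sum>j\<in>J. real_of_int (c j) * bohr_vec \<alpha> (\<nu> j) l) = 0) \<longrightarrow> (\<forall>j\<in>J. c j = 0))"

lemma sum_replace_by_combination:
  fixes X c c' :: "nat \<Rightarrow> 'a :: comm_ring_1"
  assumes "finite J" "i \<in> J"
  shows "(\<Sum>j\<in>J. c' j * (if j = i then \<Sum>k\<in>J. c k * X k else X j)) =
    (\<Sum>j\<in>J. ((if j = i then 0 else c' j) + c' i * c j) * X j)"
proof -
  have "(\<Sum>j\<in>J. c' j * (if j = i then \<Sum>k\<in>J. c k * X k else X j)) =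
      (\<Sum>j\<in>J. (if j = i then c' i * (\<Sum>k\<in>J. c k * X k) else 0) + (if j = i then 0 else c' j) * X j)"
    by (intro sum.cong) auto
  also have "\<dots> = c' i * (\<Sum>k\<in>J. c k * X k) + (\<Sum>j\<in>J. (if j = i then 0 else c' j) * X j)"
    using assms by (simp add: sum.distrib)
  finally show ?thesis by (simp add: sum_distrib_left algebra_simps sum.distrib)
qed

text \<open>A relation for the new family expands to one for the old family with coefficient
  \<open>c' i * c i\<close> at \<open>i\<close>. As \<open>c i\<close> is nonzero this forces
  \<open>c' i = 0\<close>; the remaining coefficients are then those of a relation for the old
  family.\<close>

lemma lattice_indep_replace:
  assumes "lattice_indep \<alpha> t J \<nu>" "finite J" "i \<in> J" "c i \<noteq> 0"
    and "w = (\<Sum>j\<in>J. c j * \<nu> j)"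
    and "\<And>l. l < t \<Longrightarrow> bohr_vec \<alpha> w l = (\<Sum>j\<in>J. real_of_int (c j) * bohr_vec \<alpha> (\<nu> j) l)"
  shows "lattice_indep \<alpha> t J (\<nu>(i := w))"
  unfolding lattice_indep_def
proof (intro allI impI)
  fix c' :: "nat \<Rightarrow> int"
  assume 1: "(\<Sum>j\<in>J. c' j * (\<nu>(i := w)) j) = 0"
    and 2: "\<forall>l<t. (\<Sum>j\<in>J. real_of_int (c' j) * bohr_vec \<alpha> ((\<nu>(i := w)) j) l) = 0"
  define d where "d j = (if j = i then 0 else c' j) + c' i * c j" for j
  have "(\<Sum>j\<in>J. c' j * (\<nu>(i := w)) j) = (\<Sum>j\<in>J. d j * \<nu> j)"
    unfolding d_def sum_replace_by_combination[OF assms(2,3), symmetric] assms(5)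
    by (intro sum.cong) auto
  with 1 have d1: "(\<Sum>j\<in>J. d j * \<nu> j) = 0" by simp
  have d2: "(\<Sum>j\<in>J. real_of_int (d j) * bohr_vec \<alpha> (\<nu> j) l) = 0" if "l < t" for l
  proof -
    have "(\<Sum>j\<in>J. real_of_int (d j) * bohr_vec \<alpha> (\<nu> j) l) =
      (\<Sum>j\<in>J. ((if j = i then 0 else real_of_int (c' j)) + real_of_int (c' i) * real_of_int (c j)) * bohr_vec \<alpha> (\<nu> j) l)"
      by (intro sum.cong) (auto simp: d_def)
    also have "\<dots> = (\<Sum>j\<in>J. real_of_int (c' j) * bohr_vec \<alpha> ((\<nu>(i := w)) j) l)"
      by (subst sum_replace_by_combination[OF assms(2,3), of "\<lambda>j. real_of_int (c' j)"
            "\<lambda>j. real_of_int (c j)" "\<lambda>j. bohr_vec \<alpha> (\<nu> j) l", symmetric])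
        (use assms(6)[OF that] in \<open>auto intro!: sum.cong\<close>)
    finally show ?thesis using 2 that by simp
  qed
  have d: "d j = 0" if "j \<in> J" for j
    using assms(1) d1 d2 that unfolding lattice_indep_def by blast
  from d[OF assms(3)] assms(4) have "c' i = 0" by (simp add: d_def)
  moreover have "c' j = 0" if "j \<in> J" "j \<noteq> i" for j using d[OF that(1)] that(2) \<open>c' i = 0\<close> by (simp add: d_def)
  ultimately show "\<forall>j\<in>J. c' j = 0" by blast
qed

text \<open>Guarantees that a member of Bohr norm zero is still a nonzero integer, so that its
  doublings are infinitely many.\<close>

lemma lattice_indep_nonzero:
  assumes "lattice_indep \<alpha> t J \<nu>" "finite J" "i \<in> J"
  shows "\<nu> i \<noteq> 0"
proof
  assume "\<nu> i = 0"
  define c :: "nat \<Rightarrow> int" where "c j = (if j = i then 1 else 0)" for j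
  have "(\<Sum>j\<in>J. c j * \<nu> j) = 0" using \<open>\<nu> i = 0\<close> by (intro sum.neutral) (auto simp: c_def)
  moreover have "(\<Sum>j\<in>J. real_of_int (c j) * bohr_vec \<alpha> (\<nu> j) l) = 0" for l
    using \<open>\<nu> i = 0\<close> by (intro sum.neutral) (auto simp: c_def)
  ultimately have "c i = 0" using assms unfolding lattice_indep_def by blast
  then show False by (simp add: c_def)
qed

text \<open>Summed over indices, not over the image of \<open>\<nu>\<close>, so that replacing one
  entry affects only one summand.\<close>

definition family_cost :: "(nat \<Rightarrow> real) \<Rightarrow> nat \<Rightarrow> real \<Rightarrow> nat set \<Rightarrow> (nat \<Rightarrow> int) \<Rightarrow> real" where
  "family_cost \<alpha> t r J \<nu> = (\<Sum>j\<in>J. bohr_norm \<alpha> t (\<nu> j) powr r)"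

text \<open>The chain reaching \<open>w\<close> costs at most a constant times
  \<open>bohr_norm \<alpha> t (\<nu> i) powr r\<close>, and replacing \<open>\<nu> i\<close> by
  \<open>w\<close> lowers the family cost by a fixed proportion of the same quantity. The constant
  is fixed before \<open>J\<close> and \<open>\<nu>\<close>, so it serves all iterations.\<close>

lemma halving_step:
  assumes r: "0 < r"
  obtains C where "0 \<le> C" and
    "\<And>J \<nu>. finite J \<Longrightarrow> card J \<le> M \<Longrightarrow> lin_dep t J (\<lambda>j. bohr_vec \<alpha> (\<nu> j)) \<Longrightarrow>
       lattice_indep \<alpha> t J \<nu> \<Longrightarrow>
       (\<And>j. j \<in> J \<Longrightarrow> 0 < bohr_norm \<alpha> t (\<nu> j) \<and> bohr_norm \<alpha> t (\<nu> j) < 1/2) \<Longrightarrow>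
       \<exists>i w E. i \<in> J \<and> finite E \<and> w \<in> E \<and> add_chain (\<nu> ` J) (\<nu> ` J \<union> E) \<and>
         bohr_norm \<alpha> t w \<le> bohr_norm \<alpha> t (\<nu> i) / 2 \<and> lattice_indep \<alpha> t J (\<nu>(i := w)) \<and>
         (\<Sum>u\<in>E. bohr_norm \<alpha> t u powr r) \<le>
            C * (family_cost \<alpha> t r J \<nu> - family_cost \<alpha> t r J (\<nu>(i := w)))"
proof (rule integer_halving_relation[of M])
  interpret int_seminorm "bohr_norm \<alpha> t" by (rule int_seminorm_bohr_norm)
  fix C0 assume C0: "1 \<le> C0" and rel: "\<And>J t e. finite J \<Longrightarrow> card J \<le> M \<Longrightarrow> lin_dep t J e \<Longrightarrow>
       (\<And>j. j \<in> J \<Longrightarrow> 0 < (\<Sum>l<t. \<bar>e j l\<bar>)) \<Longrightarrow>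
       \<exists>i c. i \<in> J \<and> c i \<noteq> 0 \<and>
         (\<forall>j\<in>J. \<bar>real_of_int (c j)\<bar> * (\<Sum>l<t. \<bar>e j l\<bar>) \<le> C0 * (\<Sum>l<t. \<bar>e i l\<bar>)) \<and>
         (\<Sum>l<t. \<bar>\<Sum>j\<in>J. real_of_int (c j) * e j l\<bar>) \<le> (\<Sum>l<t. \<bar>e i l\<bar>) / 2"
  define g where "g = 1 - 2 powr (-r)"
  have g: "0 < g" using r by (simp add: g_def powr_minus_divide)
  define L where "L = of_nat M * ((2 / g + 1 + of_nat M powr r) * C0 powr r)"
  have K0: "0 \<le> 2 / g + 1 + of_nat M powr r" using g by simp
  have L: "0 \<le> L" unfolding L_def using K0 by simp
  show ?thesis
  proof (rule that[of "L / g"])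
    show "0 \<le> L / g" using L g by simp
  next
    fix J \<nu>
    assume J: "finite J" "card J \<le> M" and dep: "lin_dep t J (\<lambda>j. bohr_vec \<alpha> (\<nu> j))"
      and ind: "lattice_indep \<alpha> t J \<nu>"
      and pos: "\<And>j. j \<in> J \<Longrightarrow> 0 < bohr_norm \<alpha> t (\<nu> j) \<and> bohr_norm \<alpha> t (\<nu> j) < 1/2"
    define h where "h = bohr_norm \<alpha> t"
    have "\<exists>i c. i \<in> J \<and> c i \<noteq> 0 \<and> (\<forall>j\<in>J. \<bar>real_of_int (c j)\<bar> * h (\<nu> j) \<le> C0 * h (\<nu> i)) \<and>
         (\<Sum>l<t. \<bar>\<Sum>j\<in>J. real_of_int (c j) * bohr_vec \<alpha> (\<nu> j) l\<bar>) \<le> h (\<nu> i) / 2"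
      unfolding h_def bohr_norm_eq by (rule rel[OF J dep]) (use pos in \<open>simp add: bohr_norm_eq\<close>)
    then obtain i c where i: "i \<in> J" "c i \<noteq> 0"
      and c: "\<And>j. j \<in> J \<Longrightarrow> \<bar>real_of_int (c j)\<bar> * h (\<nu> j) \<le> C0 * h (\<nu> i)"
      and half: "(\<Sum>l<t. \<bar>\<Sum>j\<in>J. real_of_int (c j) * bohr_vec \<alpha> (\<nu> j) l\<bar>) \<le> h (\<nu> i) / 2"
      by blast
    define w where "w = (\<Sum>j\<in>J. c j * \<nu> j)"
    have vec: "bohr_vec \<alpha> w l = (\<Sum>j\<in>J. real_of_int (c j) * bohr_vec \<alpha> (\<nu> j) l)" if "l < t" for l
      unfolding w_def using half pos[OF i(1)] that J(1)
      by (intro bohr_vec_combination) (auto simp: h_def)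
    have hw: "h w \<le> h (\<nu> i) / 2"
      using half unfolding h_def bohr_norm_eq by (simp add: vec)
    have hi: "0 \<le> h (\<nu> i)" by (simp add: h_def)
    have "0 \<le> C0 * h (\<nu> i)" using C0 hi by simp
    from combination_chain[OF r J, where c = c and \<nu> = \<nu> and b = "C0 * h (\<nu> i)", OF _ this] c
    obtain E where E: "finite E" "w \<in> E" "add_chain (\<nu> ` J) (\<nu> ` J \<union> E)"
      "cost r E \<le> of_nat (card J) * ((2 / g + 1 + of_nat M powr r) * (C0 * h (\<nu> i)) powr r)"
      unfolding w_def h_def g_def by blast
    have "cost r E \<le> L * h (\<nu> i) powr r"
    proof -
      have "(C0 * h (\<nu> i)) powr r = C0 powr r * h (\<nu> i) powr r" using C0 hi by (simp add: powr_mult)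
      with E(4) have "cost r E \<le> of_nat (card J) * ((2 / g + 1 + of_nat M powr r) * (C0 powr r * h (\<nu> i) powr r))"
        by simp
      also have "\<dots> \<le> of_nat M * ((2 / g + 1 + of_nat M powr r) * (C0 powr r * h (\<nu> i) powr r))"
        using J(2) K0 by (intro mult_right_mono) auto
      finally show ?thesis by (simp add: L_def mult_ac)
    qed
    also have "h (\<nu> i) powr r \<le> (h (\<nu> i) powr r - h w powr r) / g"
      using powr_halving_gap[OF _ hw r] g by (simp add: g_def h_def field_simps)
    finally have "cost r E \<le> L / g * (h (\<nu> i) powr r - h w powr r)" using L by (simp add: mult_left_mono)
    also have "h (\<nu> i) powr r - h w powr r = family_cost \<alpha> t r J \<nu> - family_cost \<alpha> t r J (\<nu>(i := w))"
    proof -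
      have "(\<Sum>j\<in>J - {i}. h ((\<nu>(i := w)) j) powr r) = (\<Sum>j\<in>J - {i}. h (\<nu> j) powr r)"
        by (intro sum.cong) auto
      then show ?thesis
        using i(1) J(1) by (simp add: family_cost_def sum.remove[of J i] flip: h_def)
    qed
    finally have cE: "(\<Sum>u\<in>E. bohr_norm \<alpha> t u powr r) \<le>
            L / g * (family_cost \<alpha> t r J \<nu> - family_cost \<alpha> t r J (\<nu>(i := w)))"
      by (simp add: cost_def)
    have "lattice_indep \<alpha> t J (\<nu>(i := w))"
      by (rule lattice_indep_replace[OF ind J(1) i w_def vec])
    with cE E hw i show "\<exists>i w E. i \<in> J \<and> finite E \<and> w \<in> E \<and> add_chain (\<nu> ` J) (\<nu> ` J \<union> E) \<and>
         bohr_norm \<alpha> t w \<le> bohr_norm \<alpha> t (\<nu> i) / 2 \<and> lattice_indep \<alpha> t J (\<nu>(i := w)) \<and>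
         (\<Sum>u\<in>E. bohr_norm \<alpha> t u powr r) \<le>
            L / g * (family_cost \<alpha> t r J \<nu> - family_cost \<alpha> t r J (\<nu>(i := w)))"
      unfolding h_def by blast
  qed
qed

section \<open>Starting families of short vectors\<close>

text \<open>Dirichlet's theorem for the frequencies \<open>of_int Y * \<alpha> l\<close> yields a
  positive multiple of \<open>Y\<close>, which lies beyond \<open>X\<close>.\<close>

lemma bohr_norm_unbounded_small:
  assumes "0 < \<epsilon>"
  obtains n :: int where "n > X" "bohr_norm \<alpha> t n \<le> \<epsilon>"
proof -
  obtain N :: nat where N: "real t / \<epsilon> + 1 < real N" using reals_Archimedean2 by blast
  moreover have "0 \<le> real t / \<epsilon>" using assms by simp
  ultimately have N0: "N > 0" by (intro Nat.gr0I) auto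
  define Y where "Y = \<bar>X\<bar> + 1"
  obtain q p where q: "0 < q" and p: "\<And>l. l < t \<Longrightarrow> \<bar>of_int q * (of_int Y * \<alpha> l) - of_int (p l)\<bar> < 1 / real N"
    using Dirichlet_approx_simult[OF N0, of t "\<lambda>l. of_int Y * \<alpha> l"] by metis
  have "bohr_norm \<alpha> t (q * Y) \<le> (\<Sum>l<t. 1 / real N)"
    unfolding bohr_norm_def
  proof (rule sum_mono)
    fix l assume "l \<in> {..<t}"
    then show "dist_int (of_int (q * Y) * \<alpha> l) \<le> 1 / real N"
      using p[of l] dist_int_le[of "of_int (q * Y) * \<alpha> l" "p l"] by (simp add: mult.assoc)
  qed
  also have "\<dots> \<le> \<epsilon>" using N N0 assms by (simp add: field_simps)
  finally have "bohr_norm \<alpha> t (q * Y) \<le> \<epsilon>" .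
  moreover have "1 * Y \<le> q * Y" using q by (intro mult_right_mono) (auto simp: Y_def)
  moreover have "X < 1 * Y" by (simp add: Y_def)
  ultimately have "q * Y > X" by linarith
  with \<open>bohr_norm \<alpha> t (q * Y) \<le> \<epsilon>\<close> show ?thesis by (intro that)
qed

text \<open>Take the largest \<open>d\<close> for which some \<open>d\<close> vectors of norm at
  most \<open>\<epsilon>\<close> are independent over the reals; then any \<open>d + 1\<close> such
  vectors are dependent. Adjoining one very large \<open>n\<close> gives \<open>d + 1\<close>
  lattice points that are independent over the integers, because no relation can balance
  \<open>n\<close>.\<close>

lemma initial_family:
  assumes \<epsilon>: "0 < \<epsilon>"
  obtains J \<nu> where "finite J" "card J \<le> Suc t" "\<And>j. j \<in> J \<Longrightarrow> bohr_norm \<alpha> t (\<nu> j) \<le> \<epsilon>"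
    "lattice_indep \<alpha> t J \<nu>"
    "\<And>\<nu>'. (\<And>j. j \<in> J \<Longrightarrow> bohr_norm \<alpha> t (\<nu>' j) \<le> \<epsilon>) \<Longrightarrow> lin_dep t J (\<lambda>j. bohr_vec \<alpha> (\<nu>' j))"
proof -
  define P where "P d \<longleftrightarrow> (\<exists>\<nu>. (\<forall>j<d. bohr_norm \<alpha> t (\<nu> j) \<le> \<epsilon>) \<and>
    \<not> lin_dep t {..<d} (\<lambda>j. bohr_vec \<alpha> (\<nu> j)))" for d
  define d where "d = (GREATEST d. P d)"
  have bound: "d \<le> t" if "P d" for d
    using that lin_dep_if_card_gt[of "{..<d}" t] by (force simp: P_def not_le[symmetric])
  have "P 0" by (auto simp: P_def lin_dep_def)
  then have Pd: "P d" unfolding d_def using bound by (rule GreatestI_nat)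
  have "\<not> P (Suc d)" using Greatest_le_nat[of P "Suc d" t] bound by (force simp: d_def)
  then have dep: "lin_dep t {..<Suc d} (\<lambda>j. bohr_vec \<alpha> (\<nu>' j))"
    if "\<And>j. j < Suc d \<Longrightarrow> bohr_norm \<alpha> t (\<nu>' j) \<le> \<epsilon>" for \<nu>'
    using that by (auto simp: P_def)
  from Pd obtain \<nu> where \<nu>: "\<And>j. j < d \<Longrightarrow> bohr_norm \<alpha> t (\<nu> j) \<le> \<epsilon>"
    and ind: "\<not> lin_dep t {..<d} (\<lambda>j. bohr_vec \<alpha> (\<nu> j))" by (auto simp: P_def)
  from dual_basis_if_not_lin_dep[OF _ ind] obtain a where
    a: "\<And>i j. i < d \<Longrightarrow> j < d \<Longrightarrow> (\<Sum>l<t. a j l * bohr_vec \<alpha> (\<nu> i) l) = (if i = j then 1 else 0)"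
    by (auto simp: Ball_def)
  \<comment> \<open>An upper bound, per unit of the coefficient of \<open>n\<close>, for what the
    old members can contribute to an integer relation.\<close>
  define X where "X = (\<Sum>j<d. (\<Sum>l<t. \<bar>a j l\<bar>) * \<bar>real_of_int (\<nu> j)\<bar>)"
  obtain n where n: "n > \<lceil>X\<rceil>" "bohr_norm \<alpha> t n \<le> \<epsilon>" using bohr_norm_unbounded_small[OF \<epsilon>] by blast
  define \<nu>' where "\<nu>' = \<nu>(d := n)"
  have split: "(\<Sum>j<Suc d. f j (\<nu>' j)) = f d n + (\<Sum>j<d. f j (\<nu> j))" for f :: "nat \<Rightarrow> int \<Rightarrow> 'z :: comm_ring_1"
    by (simp add: \<nu>'_def)
  have "lattice_indep \<alpha> t {..<Suc d} \<nu>'"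
    unfolding lattice_indep_def
  proof (intro allI impI)
    fix c :: "nat \<Rightarrow> int"
    assume "(\<Sum>j<Suc d. c j * \<nu>' j) = 0"
    then have c1: "c d * n + (\<Sum>j<d. c j * \<nu> j) = 0" by (subst (asm) split)
    assume "\<forall>l<t. (\<Sum>j<Suc d. real_of_int (c j) * bohr_vec \<alpha> (\<nu>' j) l) = 0"
    then have c2: "c d * bohr_vec \<alpha> n l + (\<Sum>j<d. c j * bohr_vec \<alpha> (\<nu> j) l) = 0" if "l < t" for l
      using that by (subst (asm) split) auto
    \<comment> \<open>The dual functional \<open>a j\<close>, applied to the vector relation,
      isolates \<open>c j\<close>.\<close>
    have cj: "real_of_int (c j) = - (c d * (\<Sum>l<t. a j l * bohr_vec \<alpha> n l))" if j: "j < d" for j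
    proof -
      have "0 = (\<Sum>l<t. a j l * (c d * bohr_vec \<alpha> n l + (\<Sum>i<d. c i * bohr_vec \<alpha> (\<nu> i) l)))"
        by (simp add: c2)
      also have "\<dots> = c d * (\<Sum>l<t. a j l * bohr_vec \<alpha> n l) + (\<Sum>i<d. c i * (\<Sum>l<t. a j l * bohr_vec \<alpha> (\<nu> i) l))"
        by (simp add: distrib_left sum.distrib sum_distrib_left mult_ac) (subst sum.swap, simp)
      also have "(\<Sum>i<d. c i * (\<Sum>l<t. a j l * bohr_vec \<alpha> (\<nu> i) l)) = (\<Sum>i<d. if i = j then real_of_int (c i) else 0)"
        using a j by (intro sum.cong) auto
      also have "\<dots> = c j" using j by simp
      finally show ?thesis by simp
    qed
    have "c d = 0"
    proof (rule ccontr)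
      assume cd: "c d \<noteq> 0"
      have "\<bar>real_of_int (c d)\<bar> * \<bar>real_of_int n\<bar> = \<bar>\<Sum>j<d. real_of_int (c j) * \<nu> j\<bar>"
      proof -
        have "real_of_int (c d) * n = - (\<Sum>j<d. real_of_int (c j) * \<nu> j)"
          using arg_cong[OF c1, of real_of_int] by simp
        then show ?thesis by (metis abs_minus_cancel abs_mult)
      qed
      also have "\<dots> \<le> (\<Sum>j<d. \<bar>real_of_int (c j)\<bar> * \<bar>real_of_int (\<nu> j)\<bar>)"
        by (simp add: abs_mult[symmetric] sum_abs)
      also have "\<dots> \<le> (\<Sum>j<d. (\<bar>real_of_int (c d)\<bar> * (\<Sum>l<t. \<bar>a j l\<bar>)) * \<bar>real_of_int (\<nu> j)\<bar>)"
      proof (intro sum_mono mult_right_mono)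
        fix j assume "j \<in> {..<d}"
        then have "\<bar>real_of_int (c j)\<bar> = \<bar>real_of_int (c d)\<bar> * \<bar>\<Sum>l<t. a j l * bohr_vec \<alpha> n l\<bar>"
          by (simp add: cj abs_mult)
        also have "\<bar>\<Sum>l<t. a j l * bohr_vec \<alpha> n l\<bar> \<le> (\<Sum>l<t. \<bar>a j l * bohr_vec \<alpha> n l\<bar>)" by (rule sum_abs)
        also have "\<dots> \<le> (\<Sum>l<t. \<bar>a j l\<bar>)"
          using abs_bohr_vec_le by (intro sum_mono) (simp add: abs_mult mult_left_le)
        finally show "\<bar>real_of_int (c j)\<bar> \<le> \<bar>real_of_int (c d)\<bar> * (\<Sum>l<t. \<bar>a j l\<bar>)"
          by (simp add: mult_left_mono)
      qed auto
      also have "\<dots> = \<bar>real_of_int (c d)\<bar> * X" by (simp add: X_def sum_distrib_left mult_ac)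
      finally have "\<bar>real_of_int n\<bar> \<le> X" using cd by simp
      with n(1) show False by linarith
    qed
    then show "\<forall>j\<in>{..<Suc d}. c j = 0" using cj by (auto simp: less_Suc_eq)
  qed
  moreover have "bohr_norm \<alpha> t (\<nu>' j) \<le> \<epsilon>" if "j \<in> {..<Suc d}" for j
    using that \<nu> n by (auto simp: \<nu>'_def less_Suc_eq)
  ultimately show ?thesis
    using bound[OF Pd] dep by (intro that[of "{..<Suc d}" \<nu>']) auto
qed

lemma add_chain_doubling: "add_chain {w} (range (\<lambda>a. 2 ^ a * w))"
proof (rule add_chainI)
  fix D :: "int \<Rightarrow> int" and n
  assume add: "\<And>u v. u \<in> range (\<lambda>a. 2 ^ a * w) \<Longrightarrow> v \<in> range (\<lambda>a. 2 ^ a * w) \<Longrightarrow>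
      u + v \<in> range (\<lambda>a. 2 ^ a * w) \<Longrightarrow> D (u + v) = D u + D v"
    and 0: "\<And>s. s \<in> {w} \<Longrightarrow> D s = 0" and n: "n \<in> range (\<lambda>a. 2 ^ a * w)"
  have "D (2 ^ a * w) = 0" for a :: nat
  proof (induction a)
    case (Suc a)
    have sum: "2 ^ a * w + 2 ^ a * w = 2 ^ Suc a * w" by simp
    have "D (2 ^ a * w + 2 ^ a * w) = D (2 ^ a * w) + D (2 ^ a * w)"
      by (rule add; (unfold sum)?; rule rangeI)
    then show ?case unfolding sum Suc by simp
  qed (use 0 in simp)
  with n show "D n = 0" by auto
qed

lemma add_chain_UN_incseq:
  assumes "\<And>k. add_chain S (B k)" "\<And>k. B k \<subseteq> B (Suc k)"
  shows "add_chain S (\<Union>k. B k)"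
proof (rule add_chainI)
  fix D :: "int \<Rightarrow> int" and n
  assume *: "\<And>u v. u \<in> (\<Union>k. B k) \<Longrightarrow> v \<in> (\<Union>k. B k) \<Longrightarrow> u + v \<in> (\<Union>k. B k) \<Longrightarrow> D (u + v) = D u + D v"
    "\<And>s. s \<in> S \<Longrightarrow> D s = 0" and "n \<in> (\<Union>k. B k)"
  then obtain k where "n \<in> B k" by blast
  moreover have "D (u + v) = D u + D v" if "u \<in> B k" "v \<in> B k" "u + v \<in> B k" for u v
    using that by (intro *(1)) auto
  ultimately show "D n = 0" using *(2) by (rule add_chainD[OF assms(1)[of k], rotated 2])
qed

text \<open>Iterating the halving step, the costs telescope. Infinitely many new elements arise, since
  the cost of the family keeps decreasing; a family member of norm zero can instead be doubled
  forever at no cost.\<close>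

lemma infinite_chain:
  assumes r: "0 < r"
  obtains C where "0 \<le> C" and
    "\<And>J \<nu> \<epsilon>. finite J \<Longrightarrow> card J \<le> M \<Longrightarrow> \<epsilon> < 1/2 \<Longrightarrow>
       (\<And>\<nu>'. (\<And>j. j \<in> J \<Longrightarrow> bohr_norm \<alpha> t (\<nu>' j) \<le> \<epsilon>) \<Longrightarrow> lin_dep t J (\<lambda>j. bohr_vec \<alpha> (\<nu>' j))) \<Longrightarrow>
       lattice_indep \<alpha> t J \<nu> \<Longrightarrow> (\<And>j. j \<in> J \<Longrightarrow> bohr_norm \<alpha> t (\<nu> j) \<le> \<epsilon>) \<Longrightarrow>
       \<exists>A. infinite A \<and> \<nu> ` J \<subseteq> A \<and> add_chain (\<nu> ` J) A \<and>
         (\<forall>F. finite F \<longrightarrow> F \<subseteq> A \<longrightarrow>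
            (\<Sum>u\<in>F. bohr_norm \<alpha> t u powr r) \<le> (1 + C) * family_cost \<alpha> t r J \<nu>)"
proof (rule halving_step[OF r, of M t \<alpha>])
  interpret int_seminorm "bohr_norm \<alpha> t" by (rule int_seminorm_bohr_norm)
  fix C assume C: "0 \<le> C" and step: "\<And>J \<nu>. finite J \<Longrightarrow> card J \<le> M \<Longrightarrow>
       lin_dep t J (\<lambda>j. bohr_vec \<alpha> (\<nu> j)) \<Longrightarrow> lattice_indep \<alpha> t J \<nu> \<Longrightarrow>
       (\<And>j. j \<in> J \<Longrightarrow> 0 < bohr_norm \<alpha> t (\<nu> j) \<and> bohr_norm \<alpha> t (\<nu> j) < 1/2) \<Longrightarrow>
       \<exists>i w E. i \<in> J \<and> finite E \<and> w \<in> E \<and> add_chain (\<nu> ` J) (\<nu> ` J \<union> E) \<and>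
         bohr_norm \<alpha> t w \<le> bohr_norm \<alpha> t (\<nu> i) / 2 \<and> lattice_indep \<alpha> t J (\<nu>(i := w)) \<and>
         (\<Sum>u\<in>E. bohr_norm \<alpha> t u powr r) \<le>
            C * (family_cost \<alpha> t r J \<nu> - family_cost \<alpha> t r J (\<nu>(i := w)))"
  show ?thesis
  proof (rule that[OF C])
    fix J and \<nu>\<^sub>0 :: "nat \<Rightarrow> int" and \<epsilon>
    assume J: "finite J" "card J \<le> M" and \<epsilon>: "\<epsilon> < 1/2"
      and dep: "\<And>\<nu>'. (\<And>j. j \<in> J \<Longrightarrow> bohr_norm \<alpha> t (\<nu>' j) \<le> \<epsilon>) \<Longrightarrow> lin_dep t J (\<lambda>j. bohr_vec \<alpha> (\<nu>' j))"
      and ind: "lattice_indep \<alpha> t J \<nu>\<^sub>0" and small: "\<And>j. j \<in> J \<Longrightarrow> bohr_norm \<alpha> t (\<nu>\<^sub>0 j) \<le> \<epsilon>"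
    define h where "h = bohr_norm \<alpha> t"
    define \<Phi> where "\<Phi> = family_cost \<alpha> t r J"
    define inv where "inv \<nu> \<longleftrightarrow> lattice_indep \<alpha> t J \<nu> \<and> (\<forall>j\<in>J. h (\<nu> j) \<le> \<epsilon>)" for \<nu>
    \<comment> \<open>One step of the iteration. The last clause demands strict descent, except when
      some member has norm zero, where keeping the family unchanged is allowed.\<close>
    define good where "good \<nu> \<nu>' E \<longleftrightarrow> inv \<nu>' \<and> finite E \<and> \<nu>' ` J \<subseteq> \<nu> ` J \<union> E \<and>
      add_chain (\<nu> ` J) (\<nu> ` J \<union> E) \<and> cost r E \<le> C * (\<Phi> \<nu> - \<Phi> \<nu>') \<and>
      (\<Phi> \<nu>' < \<Phi> \<nu> \<or> (\<exists>j\<in>J. h (\<nu> j) = 0))" for \<nu> \<nu>' E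
    have "\<exists>p. inv \<nu> \<longrightarrow> good \<nu> (fst p) (snd p)" for \<nu>
    proof (cases "inv \<nu>")
      case True
      show ?thesis
      proof (cases "\<exists>j\<in>J. h (\<nu> j) = 0")
        case zero: True
        have "add_chain (\<nu> ` J) (\<nu> ` J)" by (auto simp: add_chain_def)
        with True zero have "good \<nu> \<nu> {}" by (auto simp: good_def cost_def)
        then show ?thesis by (intro exI[of _ "(\<nu>, {})"]) simp
      next
        case nz: False
        have pos: "0 < h (\<nu> j) \<and> h (\<nu> j) < 1/2" if "j \<in> J" for j
          using that nz True \<epsilon> h_nonneg[of "\<nu> j"] unfolding inv_def h_def by (force simp: less_le)
        have "lin_dep t J (\<lambda>j. bohr_vec \<alpha> (\<nu> j))" using True by (intro dep) (auto simp: inv_def h_def)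
        from step[OF J this _ pos[unfolded h_def]] True
        obtain i w E where E: "i \<in> J" "finite E" "w \<in> E" "add_chain (\<nu> ` J) (\<nu> ` J \<union> E)"
          "h w \<le> h (\<nu> i) / 2" "lattice_indep \<alpha> t J (\<nu>(i := w))"
          "cost r E \<le> C * (\<Phi> \<nu> - \<Phi> (\<nu>(i := w)))"
          unfolding inv_def h_def \<Phi>_def cost_def by blast
        have hw: "h w < h (\<nu> i)" using E(5) pos[OF E(1)] by linarith
        have "h w powr r < h (\<nu> i) powr r"
          using hw r by (intro powr_less_mono2) (auto simp: h_def)
        then have "\<Phi> (\<nu>(i := w)) < \<Phi> \<nu>"
          unfolding \<Phi>_def family_cost_def h_def
          using E(1) J(1) by (intro sum_strict_mono_ex1) auto
        moreover have "inv (\<nu>(i := w))" using True E(1,6) hw by (auto simp: inv_def)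
        ultimately have "good \<nu> (\<nu>(i := w)) E" using E by (auto simp: good_def)
        then show ?thesis by (intro exI[of _ "(\<nu>(i := w), E)"]) simp
      qed
    qed simp
    then obtain f where f: "\<And>\<nu>. inv \<nu> \<Longrightarrow> good \<nu> (fst (f \<nu>)) (snd (f \<nu>))" by metis
    define V where "V k = ((\<lambda>\<nu>. fst (f \<nu>)) ^^ k) \<nu>\<^sub>0" for k
    define E where "E k = snd (f (V k))" for k
    have V0: "V 0 = \<nu>\<^sub>0" and VS: "V (Suc k) = fst (f (V k))" for k by (simp_all add: V_def)
    have inv: "inv (V k)" for k
    proof (induction k)
      case 0
      then show ?case using ind small by (simp add: V0 inv_def h_def)
    next
      case (Suc k)
      then show ?case using f by (auto simp: VS good_def)
    qed
    have good: "good (V k) (V (Suc k)) (E k)" for k using f[OF inv] by (simp add: VS E_def)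
    define B where "B k = \<nu>\<^sub>0 ` J \<union> (\<Union>i<k. E i)" for k
    have BS: "B (Suc k) = B k \<union> (V k ` J \<union> E k)" if "V k ` J \<subseteq> B k" for k
      using that by (auto simp: B_def lessThan_Suc)
    have B: "V k ` J \<subseteq> B k \<and> add_chain (\<nu>\<^sub>0 ` J) (B k)" for k
    proof (induction k)
      case 0
      then show ?case by (auto simp: B_def V0 add_chain_def)
    next
      case (Suc k)
      then have "V (Suc k) ` J \<subseteq> B (Suc k)" using good[of k] BS[of k] unfolding good_def by blast
      moreover have "add_chain (\<nu>\<^sub>0 ` J) (B (Suc k))"
        using Suc good[of k] BS[of k] by (auto simp: good_def intro: add_chain_union)
      ultimately show ?case ..
    qed
    have finB: "finite (B k)" for k using J(1) good unfolding B_def good_def by blast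
    have costB: "cost r (B k) \<le> (1 + C) * \<Phi> \<nu>\<^sub>0" for k
    proof -
      \<comment> \<open>Telescoping: the new elements of each step are paid for by the drop of
        \<open>\<Phi>\<close>, which never falls below zero.\<close>
      have "cost r (B k) \<le> \<Phi> \<nu>\<^sub>0 + C * (\<Phi> \<nu>\<^sub>0 - \<Phi> (V k))"
      proof (induction k)
        case 0
        have "cost r (\<nu>\<^sub>0 ` J) \<le> \<Phi> \<nu>\<^sub>0"
          unfolding cost_def \<Phi>_def family_cost_def
          by (rule order_trans[OF sum_image_le]) (use J in \<open>auto simp: o_def\<close>)
        then show ?case by (simp add: B_def V0)
      next
        case (Suc k)
        have "B (Suc k) = B k \<union> E k" by (auto simp: B_def lessThan_Suc)
        then have "cost r (B (Suc k)) \<le> cost r (B k) + cost r (E k)"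
          using cost_union_le[OF finB[of k], of "E k" r] good[of k] by (simp add: good_def)
        also have "\<dots> \<le> \<Phi> \<nu>\<^sub>0 + C * (\<Phi> \<nu>\<^sub>0 - \<Phi> (V k)) + C * (\<Phi> (V k) - \<Phi> (V (Suc k)))"
          using Suc good[of k] by (simp add: good_def)
        finally show ?case by (simp add: algebra_simps)
      qed
      also have "\<dots> \<le> \<Phi> \<nu>\<^sub>0 + C * \<Phi> \<nu>\<^sub>0"
        using C by (intro add_left_mono mult_left_mono) (auto simp: \<Phi>_def family_cost_def sum_nonneg)
      finally show ?thesis by (simp add: algebra_simps)
    qed
    have incB: "B k \<subseteq> B (Suc k)" for k by (auto simp: B_def)
    then have mono: "mono B" by (intro incseq_SucI)
    define A where "A = (\<Union>k. B k)"
    have chainA: "add_chain (\<nu>\<^sub>0 ` J) A" unfolding A_def using B incB by (intro add_chain_UN_incseq) auto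
    have \<nu>A: "\<nu>\<^sub>0 ` J \<subseteq> A" by (auto simp: A_def B_def)
    have costA: "cost r F \<le> (1 + C) * \<Phi> \<nu>\<^sub>0" if F: "finite F" "F \<subseteq> A" for F
    proof -
      have "\<exists>k. F \<subseteq> B k" using F
      proof (induction F rule: finite_induct)
        case (insert x F)
        then obtain k k' where "F \<subseteq> B k" "x \<in> B k'" by (auto simp: A_def)
        with monoD[OF mono, of k "max k k'"] monoD[OF mono, of k' "max k k'"] show ?case
          by (intro exI[of _ "max k k'"]) auto
      qed auto
      then obtain k where "F \<subseteq> B k" ..
      then show ?thesis using cost_mono[OF finB] costB order_trans by blast
    qed
    show "\<exists>A. infinite A \<and> \<nu>\<^sub>0 ` J \<subseteq> A \<and> add_chain (\<nu>\<^sub>0 ` J) A \<and>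
         (\<forall>F. finite F \<longrightarrow> F \<subseteq> A \<longrightarrow>
            (\<Sum>u\<in>F. bohr_norm \<alpha> t u powr r) \<le> (1 + C) * family_cost \<alpha> t r J \<nu>\<^sub>0)"
    proof (cases "\<exists>k. \<exists>j\<in>J. h (V k j) = 0")
      case True
      then obtain k j where kj: "j \<in> J" "h (V k j) = 0" by blast
      define w where "w = V k j"
      define Z where "Z = range (\<lambda>a :: nat. 2 ^ a * w)"
      have w0: "w \<noteq> 0" unfolding w_def using inv[of k] J(1) kj(1)
        by (intro lattice_indep_nonzero) (auto simp: inv_def)
      have "inj (\<lambda>a :: nat. 2 ^ a * w)" using w0 by (auto simp: inj_on_def)
      then have "infinite Z" unfolding Z_def by (simp add: finite_image_iff)
      have hZ: "h z = 0" if "z \<in> Z" for z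
      proof -
        from that obtain a :: nat where "z = 2 ^ a * w" by (auto simp: Z_def)
        then have "h z \<le> 0" using h_mult[of "2 ^ a" w] kj(2) by (simp add: h_def w_def)
        then show ?thesis using h_nonneg[of z] by (simp add: h_def)
      qed
      have "w \<in> A" using B[of k] kj(1) by (auto simp: A_def w_def)
      then have "add_chain (\<nu>\<^sub>0 ` J) (A \<union> Z)"
        unfolding Z_def by (intro add_chain_union[OF chainA add_chain_doubling]) simp
      moreover have "cost r F \<le> (1 + C) * \<Phi> \<nu>\<^sub>0" if F: "finite F" "F \<subseteq> A \<union> Z" for F
      proof -
        have "cost r F = cost r (F \<inter> A)"
          unfolding cost_def using F r hZ by (intro sum.mono_neutral_right) (auto simp: h_def)
        also have "\<dots> \<le> (1 + C) * \<Phi> \<nu>\<^sub>0" using F by (intro costA) auto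
        finally show ?thesis .
      qed
      ultimately show ?thesis using \<open>infinite Z\<close> \<nu>A
        by (intro exI[of _ "A \<union> Z"]) (auto simp: cost_def \<Phi>_def)
    next
      case False
      have "\<Phi> (V (Suc k)) < \<Phi> (V k)" for k using good[of k] False by (auto simp: good_def)
      then have "\<Phi> (V l) < \<Phi> (V k)" if "k < l" for k l
        using that by (rule lift_Suc_mono_less[where f = "\<lambda>k. - \<Phi> (V k)", simplified])
      then have "inj (\<lambda>k. \<Phi> (V k))" by (metis injI linorder_neqE_nat less_irrefl)
      then have inf: "infinite (range (\<lambda>k. \<Phi> (V k)))" by (rule range_inj_infinite)
      \<comment> \<open>All families \<open>V k\<close> take values in \<open>A\<close>; a finite
        \<open>A\<close> would allow only finitely many families on \<open>J\<close>, against the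
        infinitely many values of \<open>\<Phi>\<close>.\<close>
      have "infinite A"
      proof
        assume "finite A"
        then have "finite (\<Phi> ` (J \<rightarrow>\<^sub>E A))" using J(1) by (intro finite_imageI finite_PiE) auto
        moreover have "range (\<lambda>k. \<Phi> (V k)) \<subseteq> \<Phi> ` (J \<rightarrow>\<^sub>E A)"
        proof safe
          fix k
          have "\<Phi> (V k) = \<Phi> (restrict (V k) J)" by (simp add: \<Phi>_def family_cost_def)
          moreover have "restrict (V k) J \<in> J \<rightarrow>\<^sub>E A" using B[of k] by (auto simp: A_def)
          ultimately show "\<Phi> (V k) \<in> \<Phi> ` (J \<rightarrow>\<^sub>E A)" by blast
        qed
        ultimately show False using inf finite_subset by blast
      qed
      then show ?thesis using chainA \<nu>A costA by (intro exI[of _ A]) (auto simp: cost_def \<Phi>_def)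
    qed
  qed
qed

section \<open>Finiteness of the set of survivors\<close>

text \<open>The differences of nearest integers are additive along \<open>A\<close> and vanish on
  \<open>S\<close>, hence on all of \<open>A\<close>. So \<open>n * (x - y)\<close> stays bounded
  while \<open>n\<close> runs through an infinite set.\<close>

lemma add_chain_determines:
  assumes chain: "add_chain S A" and "infinite A"
    and x: "\<And>n. n \<in> A \<Longrightarrow> dist_int (of_int n * x) \<le> 1/6"
    and y: "\<And>n. n \<in> A \<Longrightarrow> dist_int (of_int n * y) \<le> 1/6"
    and eq: "\<And>s. s \<in> S \<Longrightarrow> round (of_int s * x) = round (of_int s * y)"
  shows "x = y"
proof (rule ccontr)
  assume "x \<noteq> y"
  define D where "D n = round (of_int n * x) - round (of_int n * y)" for n :: int
  have D: "D n = 0" if "n \<in> A" for n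
  proof (rule add_chainD[OF chain _ _ that])
    fix u v assume uv: "u \<in> A" "v \<in> A" "u + v \<in> A"
    have "round (of_int (u + v) * z) = round (of_int u * z) + round (of_int v * z)"
      if "\<And>n. n \<in> A \<Longrightarrow> dist_int (of_int n * z) \<le> 1/6" for z
      using round_add_of_dist_int_le[of "of_int u * z" "of_int v * z"] that[OF uv(1)] that[OF uv(2)] that[OF uv(3)]
      by (simp add: distrib_right)
    from this[OF x] this[OF y] show "D (u + v) = D u + D v" by (simp add: D_def)
  qed (use eq in \<open>simp add: D_def\<close>)
  have "\<bar>real_of_int n\<bar> \<le> 1 / \<bar>x - y\<bar>" if "n \<in> A" for n
  proof -
    have "round (of_int n * x) = round (of_int n * y)" using D[OF that] by (simp add: D_def)
    then have "\<bar>of_int n * x - of_int n * y\<bar> \<le> 1"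
      using x[OF that] y[OF that] unfolding dist_int_def by linarith
    then have "\<bar>real_of_int n\<bar> * \<bar>x - y\<bar> \<le> 1" by (simp add: right_diff_distrib flip: abs_mult)
    then show ?thesis using \<open>x \<noteq> y\<close> by (simp add: field_simps)
  qed
  then have "\<bar>n\<bar> \<le> \<lfloor>1 / \<bar>x - y\<bar>\<rfloor>" if "n \<in> A" for n using that by (simp add: le_floor_iff)
  then have "A \<subseteq> {- \<lfloor>1 / \<bar>x - y\<bar>\<rfloor>..\<lfloor>1 / \<bar>x - y\<bar>\<rfloor>}" by (force simp: abs_le_iff)
  then show False using \<open>infinite A\<close> finite_subset by blast
qed

text \<open>A surviving \<beta> is determined by its nearest integers at the starting elements, and
  for bounded \<beta> these have only finitely many possible values.\<close>

lemma cheap_set_with_finite_zeros: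
  assumes r: "0 < r" and \<delta>: "0 < \<delta>"
  obtains A :: "int set" where "infinite A"
    "\<And>F. finite F \<Longrightarrow> F \<subseteq> A \<Longrightarrow> (\<Sum>u\<in>F. bohr_norm \<alpha> t u powr r) \<le> \<delta>"
    "\<And>X. finite {\<beta>. 0 \<le> \<beta> \<and> \<beta> \<le> X \<and> (\<forall>n\<in>A. dist_int (of_int n * \<beta>) \<le> 1/6)}"
proof (rule infinite_chain[OF r, of "Suc t" \<alpha> t])
  fix C assume C: "0 \<le> C" and chain: "\<And>J \<nu> \<epsilon>. finite J \<Longrightarrow> card J \<le> Suc t \<Longrightarrow> \<epsilon> < 1/2 \<Longrightarrow>
       (\<And>\<nu>'. (\<And>j. j \<in> J \<Longrightarrow> bohr_norm \<alpha> t (\<nu>' j) \<le> \<epsilon>) \<Longrightarrow> lin_dep t J (\<lambda>j. bohr_vec \<alpha> (\<nu>' j))) \<Longrightarrow>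
       lattice_indep \<alpha> t J \<nu> \<Longrightarrow> (\<And>j. j \<in> J \<Longrightarrow> bohr_norm \<alpha> t (\<nu> j) \<le> \<epsilon>) \<Longrightarrow>
       \<exists>A. infinite A \<and> \<nu> ` J \<subseteq> A \<and> add_chain (\<nu> ` J) A \<and>
         (\<forall>F. finite F \<longrightarrow> F \<subseteq> A \<longrightarrow>
            (\<Sum>u\<in>F. bohr_norm \<alpha> t u powr r) \<le> (1 + C) * family_cost \<alpha> t r J \<nu>)"
  interpret int_seminorm "bohr_norm \<alpha> t" by (rule int_seminorm_bohr_norm)
  \<comment> \<open>The budget of each of at most \<open>Suc t\<close> starting elements, allowing
    for the factor \<open>1 + C\<close>. The matching norm \<open>\<epsilon>\<close> is also kept
    below 1/2, as the halving steps require.\<close>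
  define \<theta> where "\<theta> = \<delta> / ((1 + C) * real (Suc t))"
  define \<epsilon> where "\<epsilon> = min (1/4) (\<theta> powr (1/r))"
  have \<theta>: "0 < \<theta>" using \<delta> C by (simp add: \<theta>_def)
  then have \<epsilon>: "0 < \<epsilon>" "\<epsilon> < 1/2" by (auto simp: \<epsilon>_def)
  have "\<epsilon> powr r \<le> (\<theta> powr (1/r)) powr r" using \<epsilon> r by (intro powr_mono2) (auto simp: \<epsilon>_def)
  also have "\<dots> = \<theta>" using \<theta> r by (simp add: powr_powr)
  finally have \<epsilon>r: "\<epsilon> powr r \<le> \<theta>" .
  from initial_family[OF \<epsilon>(1), of t \<alpha>] obtain J \<nu> where J: "finite J" "card J \<le> Suc t"
    "\<And>j. j \<in> J \<Longrightarrow> bohr_norm \<alpha> t (\<nu> j) \<le> \<epsilon>" "lattice_indep \<alpha> t J \<nu>"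
    and dep: "\<And>\<nu>'. (\<And>j. j \<in> J \<Longrightarrow> bohr_norm \<alpha> t (\<nu>' j) \<le> \<epsilon>) \<Longrightarrow> lin_dep t J (\<lambda>j. bohr_vec \<alpha> (\<nu>' j))"
    by metis
  obtain A where A: "infinite A" "\<nu> ` J \<subseteq> A" "add_chain (\<nu> ` J) A"
    "\<And>F. finite F \<Longrightarrow> F \<subseteq> A \<Longrightarrow> (\<Sum>u\<in>F. bohr_norm \<alpha> t u powr r) \<le> (1 + C) * family_cost \<alpha> t r J \<nu>"
    using chain[OF J(1,2) \<epsilon>(2) dep J(4,3)] by metis
  have "family_cost \<alpha> t r J \<nu> \<le> (\<Sum>j\<in>J. \<theta>)"
    unfolding family_cost_def using J(3) r \<epsilon>r by (intro sum_mono order_trans[OF powr_mono2 \<epsilon>r]) auto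
  also have "\<dots> \<le> real (Suc t) * \<theta>" using J(2) \<theta> by (simp add: mult_right_mono del: of_nat_Suc)
  finally have "(1 + C) * family_cost \<alpha> t r J \<nu> \<le> (1 + C) * (real (Suc t) * \<theta>)"
    using C by (intro mult_left_mono) auto
  also have "\<dots> = \<delta>" using C by (simp add: \<theta>_def del: of_nat_Suc)
  finally have cost: "(1 + C) * family_cost \<alpha> t r J \<nu> \<le> \<delta>" .
  show ?thesis
  proof (rule that[OF A(1)])
    show "(\<Sum>u\<in>F. bohr_norm \<alpha> t u powr r) \<le> \<delta>" if "finite F" "F \<subseteq> A" for F
      using A(4)[OF that] cost by linarith
  next
    fix X :: real
    let ?Z = "{\<beta>. 0 \<le> \<beta> \<and> \<beta> \<le> X \<and> (\<forall>n\<in>A. dist_int (of_int n * \<beta>) \<le> 1/6)}"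
    define \<rho> where "\<rho> \<beta> = (\<lambda>j\<in>J. round (of_int (\<nu> j) * \<beta>))" for \<beta> :: real
    have "inj_on \<rho> ?Z"
    proof (rule inj_onI)
      fix x y assume xy: "x \<in> ?Z" "y \<in> ?Z" "\<rho> x = \<rho> y"
      have "round (of_int (\<nu> j) * x) = round (of_int (\<nu> j) * y)" if "j \<in> J" for j
        using fun_cong[OF xy(3), of j] that by (simp add: \<rho>_def)
      then show "x = y" using xy(1,2) by (intro add_chain_determines[OF A(3,1)]) auto
    qed
    moreover have "\<rho> ` ?Z \<subseteq> PiE J (\<lambda>j. {- \<lceil>\<bar>of_int (\<nu> j)\<bar> * X + 1\<rceil>..\<lceil>\<bar>of_int (\<nu> j)\<bar> * X + 1\<rceil>})"
    proof (rule image_subsetI, unfold \<rho>_def)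
      fix \<beta> :: real assume "\<beta> \<in> ?Z"
      then have \<beta>: "0 \<le> \<beta>" "\<beta> \<le> X" by auto
      show "(\<lambda>j\<in>J. round (of_int (\<nu> j) * \<beta>)) \<in> PiE J (\<lambda>j. {- \<lceil>\<bar>of_int (\<nu> j)\<bar> * X + 1\<rceil>..\<lceil>\<bar>of_int (\<nu> j)\<bar> * X + 1\<rceil>})"
      proof (rule restrict_PiE_iff[THEN iffD2], rule ballI)
        fix j
        have "\<bar>of_int (\<nu> j) * \<beta>\<bar> \<le> \<bar>of_int (\<nu> j)\<bar> * X" using \<beta> by (simp add: abs_mult mult_left_mono)
        then have "\<bar>real_of_int (round (of_int (\<nu> j) * \<beta>))\<bar> \<le> \<bar>of_int (\<nu> j)\<bar> * X + 1"
          using of_int_round_abs_le[of "of_int (\<nu> j) * \<beta>"] by linarith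
        then show "round (of_int (\<nu> j) * \<beta>) \<in> {- \<lceil>\<bar>of_int (\<nu> j)\<bar> * X + 1\<rceil>..\<lceil>\<bar>of_int (\<nu> j)\<bar> * X + 1\<rceil>}"
          by simp linarith
      qed
    qed
    moreover have "finite (PiE J (\<lambda>j. {- \<lceil>\<bar>real_of_int (\<nu> j)\<bar> * X + 1\<rceil>..\<lceil>\<bar>real_of_int (\<nu> j)\<bar> * X + 1\<rceil>}))"
      using J(1) by (intro finite_PiE) auto
    ultimately show "finite ?Z" by (rule inj_on_finite)
  qed
qed

section \<open>Separation from a subgroup by Bohr sets\<close>

text \<open>The property of trigonometric polynomials with frequencies in \<open>G\<close> that is
  used: the mean against every other character vanishes.\<close>

definition mean_orthogonal :: "real set \<Rightarrow> (nat \<Rightarrow> real) \<Rightarrow> bool" where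
  "mean_orthogonal G f \<longleftrightarrow> (\<forall>\<mu>. \<mu> \<notin> G \<longrightarrow>
     (\<lambda>N. (\<Sum>n<N. of_real (f n) * cis (2 * pi * (real n * \<mu>))) / of_nat N) \<longlonglongrightarrow> 0)"

text \<open>The geometric sum with ratio \<open>cis (2 * pi * \<mu>)\<close> stays bounded, as the
  ratio differs from 1 for non-integral \<mu>.\<close>

lemma mean_orthogonal_1:
  assumes "\<int> \<subseteq> G"
  shows "mean_orthogonal G (\<lambda>_. 1)"
  unfolding mean_orthogonal_def
proof (intro allI impI)
  fix \<mu> assume "\<mu> \<notin> G"
  define z where "z = cis (2 * pi * \<mu>)"
  have "z \<noteq> 1"
  proof
    assume "z = 1"
    then have "cos (2 * pi * \<mu>) = 1" by (simp add: z_def complex_eq_iff)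
    then obtain m :: int where "2 * pi * \<mu> = m * 2 * pi" by (auto simp: cos_one_2pi_int)
    then have "\<mu> = of_int m" by simp
    with assms \<open>\<mu> \<notin> G\<close> Ints_of_int[of m] show False by blast
  qed
  have sum: "(\<Sum>n<N. of_real 1 * cis (2 * pi * (real n * \<mu>))) = (z ^ N - 1) / (z - 1)" for N
  proof -
    have "cis (2 * pi * (real n * \<mu>)) = z ^ n" for n
      by (simp add: z_def Complex.DeMoivre mult_ac)
    then show ?thesis using geometric_sum[OF \<open>z \<noteq> 1\<close>, of N] by simp
  qed
  have bound: "norm ((z ^ N - 1) / (z - 1)) \<le> 2 / norm (z - 1)" for N
  proof -
    have "norm (z ^ N - 1) \<le> norm (z ^ N) + norm (1 :: complex)" by (rule norm_triangle_ineq4)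
    also have "\<dots> = 2" by (simp add: norm_power z_def)
    finally show ?thesis by (simp add: norm_divide divide_right_mono)
  qed
  show "(\<lambda>N. (\<Sum>n<N. of_real 1 * cis (2 * pi * (real n * \<mu>))) / of_nat N) \<longlonglongrightarrow> 0"
    unfolding sum
  proof (rule Lim_null_comparison)
    show "\<forall>\<^sub>F N in sequentially. norm ((z ^ N - 1) / (z - 1) / of_nat N) \<le> 2 / norm (z - 1) / real N"
      unfolding norm_divide[of _ "of_nat _"] norm_of_nat
      by (intro always_eventually allI divide_right_mono bound) simp
    show "(\<lambda>N. 2 / norm (z - 1) / real N) \<longlonglongrightarrow> 0" by (rule lim_const_over_n)
  qed
qed

text \<open>A cosine of frequency \<open>g\<close> shifts the character by \<open>g\<close> and
  \<open>- g\<close>, and shifts by elements of the subgroup cannot lead from outside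
  \<open>G\<close> into \<open>G\<close>.\<close>

lemma mean_orthogonal_mult_cos:
  assumes G: "circle_subgroup G" and "g \<in> G" and f: "mean_orthogonal G f"
  shows "mean_orthogonal G (\<lambda>n. f n * ((1 + cos (2 * pi * (real n * g))) / 2))"
  unfolding mean_orthogonal_def
proof (intro allI impI)
  fix \<mu> assume \<mu>: "\<mu> \<notin> G"
  have "0 \<in> G" using G by (auto simp: circle_subgroup_def)
  then have neg: "- g \<in> G" using G \<open>g \<in> G\<close> by (force simp: circle_subgroup_def dest!: bspec)
  have plus: "\<mu> + g \<notin> G"
  proof
    assume "\<mu> + g \<in> G"
    then have "\<mu> + g - g \<in> G" using G \<open>g \<in> G\<close> unfolding circle_subgroup_def by blast
    with \<mu> show False by simp
  qed
  have minus: "\<mu> - g \<notin> G"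
  proof
    assume "\<mu> - g \<in> G"
    then have "\<mu> - g - (- g) \<in> G" using G neg unfolding circle_subgroup_def by blast
    with \<mu> show False by simp
  qed
  define S where "S \<nu> N = (\<Sum>n<N. of_real (f n) * cis (2 * pi * (real n * \<nu>))) / of_nat N" for \<nu> N
  have summand: "of_real (f n * ((1 + cos (2 * pi * (real n * g))) / 2)) * cis (2 * pi * (real n * \<mu>)) =
      of_real (f n) * cis (2 * pi * (real n * \<mu>)) / 2 + of_real (f n) * cis (2 * pi * (real n * (\<mu> + g))) / 4
      + of_real (f n) * cis (2 * pi * (real n * (\<mu> - g))) / 4" for n
  proof -
    have c: "complex_of_real (cos x) = (cis x + cis (- x)) / 2" for x
      by (simp add: complex_eq_iff)
    have 1: "cis (2 * pi * (real n * (\<mu> + g))) = cis (2 * pi * (real n * \<mu>)) * cis (2 * pi * (real n * g))"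
      and 2: "cis (2 * pi * (real n * (\<mu> - g))) = cis (2 * pi * (real n * \<mu>)) * cis (- (2 * pi * (real n * g)))"
      by (simp_all add: cis_mult algebra_simps)
    show ?thesis unfolding 1 2 by (simp add: c field_simps)
  qed
  have "(\<Sum>n<N. of_real (f n * ((1 + cos (2 * pi * (real n * g))) / 2)) * cis (2 * pi * (real n * \<mu>))) / of_nat N =
      S \<mu> N / 2 + S (\<mu> + g) N / 4 + S (\<mu> - g) N / 4" for N
    unfolding summand sum.distrib S_def by (simp add: add_divide_distrib mult.commute[of "of_nat N"] flip: sum_divide_distrib)
  moreover have "(\<lambda>N. S \<mu> N / 2 + S (\<mu> + g) N / 4 + S (\<mu> - g) N / 4) \<longlonglongrightarrow> 0 / 2 + 0 / 4 + 0 / 4"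
    using f \<mu> plus minus unfolding mean_orthogonal_def S_def
    by (intro tendsto_add tendsto_divide tendsto_const) auto
  ultimately show "(\<lambda>N. (\<Sum>n<N. of_real (f n * ((1 + cos (2 * pi * (real n * g))) / 2)) *
      cis (2 * pi * (real n * \<mu>))) / of_nat N) \<longlonglongrightarrow> 0" by simp
qed

section \<open>Cosine estimates and the density of Bohr sets\<close>

lemma cos_dist_int: "cos (2 * pi * dist_int x) = cos (2 * pi * x)"
proof -
  have "cos (2 * pi * dist_int x) = cos \<bar>2 * pi * (x - of_int (round x))\<bar>"
    by (simp add: dist_int_def abs_mult)
  also have "\<dots> = cos (2 * pi * x - 2 * pi * of_int (round x))"
    by (simp only: cos_abs_real right_diff_distrib)
  also have "\<dots> = cos (2 * pi * x)" by (simp add: cos_diff)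
  finally show ?thesis .
qed

lemma cos_ge_of_dist_int_le:
  assumes "dist_int x \<le> \<delta>" "\<delta> \<le> 1/2"
  shows "cos (2 * pi * \<delta>) \<le> cos (2 * pi * x)"
proof -
  have "cos (2 * pi * \<delta>) \<le> cos (2 * pi * dist_int x)"
    using assms mult_left_mono[of \<delta> "1/2" "2 * pi"] by (intro cos_monotone_0_pi_le) auto
  then show ?thesis by (simp add: cos_dist_int)
qed

lemma cos_le_of_dist_int_ge:
  assumes "\<delta> \<le> dist_int x" "0 \<le> \<delta>"
  shows "cos (2 * pi * x) \<le> cos (2 * pi * \<delta>)"
proof -
  have "cos (2 * pi * dist_int x) \<le> cos (2 * pi * \<delta>)"
    using assms mult_left_mono[OF dist_int_le_half[of x], of "2 * pi"] by (intro cos_monotone_0_pi_le) auto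
  then show ?thesis by (simp add: cos_dist_int)
qed

text \<open>Pigeonhole: one of the \<open>q ^ t\<close> cells of the torus receives its full share
  of the indices. Points of one cell differ by at most \<open>1 / q\<close> in each coordinate, so
  subtracting the least index of the cell lands in the Bohr set.\<close>

lemma bohr_set_density:
  fixes \<alpha> :: "nat \<Rightarrow> real"
  assumes q: "0 < q"
  shows "N \<le> card {n. n < N \<and> (\<forall>l<t. dist_int (real n * \<alpha> l) \<le> 1 / real q)} * q ^ t"
    (is "N \<le> card ?B * _")
proof -
  define cell where "cell n = (\<lambda>l\<in>{..<t}. nat \<lfloor>real q * frac (real n * \<alpha> l)\<rfloor>)" for n :: nat
  have "cell n \<in> {..<t} \<rightarrow>\<^sub>E {..<q}" for n
  proof -
    have "nat \<lfloor>real q * frac (real n * \<alpha> l)\<rfloor> < q" for l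
    proof -
      have "real q * frac (real n * \<alpha> l) < real q * 1"
        using q frac_lt_1 by (intro mult_strict_left_mono) auto
      moreover have "0 \<le> real q * frac (real n * \<alpha> l)" by simp
      ultimately show ?thesis by linarith
    qed
    then show ?thesis by (simp add: cell_def)
  qed
  then have "cell \<in> {..<N} \<rightarrow> ({..<t} \<rightarrow>\<^sub>E {..<q})" by auto
  moreover have "({..<t} \<rightarrow>\<^sub>E {..<q}) \<noteq> {}" using q by (auto simp: PiE_eq_empty_iff)
  ultimately obtain y where y: "N \<le> card (cell -` {y} \<inter> {..<N}) * q ^ t"
    using pigeonhole_card[of cell "{..<N}" "{..<t} \<rightarrow>\<^sub>E {..<q}"]
    by (auto simp: finite_PiE card_PiE)
  define P where "P = cell -` {y} \<inter> {..<N}"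
  show ?thesis
  proof (cases "P = {}")
    case True
    then show ?thesis using y by (simp add: P_def)
  next
    case False
    have finP: "finite P" by (simp add: P_def)
    define m where "m = Min P"
    have m: "m \<in> P" "\<And>n. n \<in> P \<Longrightarrow> m \<le> n" using False finP by (auto simp: m_def)
    have "(\<lambda>n. n - m) ` P \<subseteq> ?B"
    proof (intro image_subsetI CollectI conjI allI impI)
      fix n assume n: "n \<in> P"
      then show "n - m < N" by (auto simp: P_def)
      fix l assume l: "l < t"
      define u v where "u = real n * \<alpha> l" and "v = real m * \<alpha> l"
      have "cell n = cell m" using n m(1) by (simp add: P_def)
      then have "cell n l = cell m l" by simp
      then have "nat \<lfloor>real q * frac u\<rfloor> = nat \<lfloor>real q * frac v\<rfloor>"
        using l by (simp add: cell_def u_def v_def)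
      moreover have "0 \<le> real q * frac u" "0 \<le> real q * frac v" by simp_all
      ultimately have "\<bar>real q * frac u - real q * frac v\<bar> \<le> 1" by linarith
      then have "real q * \<bar>frac u - frac v\<bar> \<le> 1" by (simp add: abs_mult flip: right_diff_distrib)
      then have "\<bar>frac u - frac v\<bar> \<le> 1 / real q" using q by (simp add: field_simps)
      moreover have "dist_int (u - v) \<le> \<bar>(u - v) - of_int (\<lfloor>u\<rfloor> - \<lfloor>v\<rfloor>)\<bar>" by (rule dist_int_le)
      moreover have "real (n - m) * \<alpha> l = u - v" using m(2)[OF n] by (simp add: u_def v_def algebra_simps of_nat_diff)
      ultimately show "dist_int (real (n - m) * \<alpha> l) \<le> 1 / real q" by (simp add: frac_def)
    qed
    moreover have "inj_on (\<lambda>n. n - m) P" by (rule inj_on_diff_nat) (use m in auto)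
    ultimately have "card P \<le> card ?B" by (intro card_inj_on_le) auto
    then have "card P * q ^ t \<le> card ?B * q ^ t" by (rule mult_le_mono1)
    with y show ?thesis unfolding P_def by (rule order_trans)
  qed
qed

text \<open>If all \<open>n\<close> in a Bohr set with frequencies in \<open>G\<close> had \<open>n * \<beta>\<close> close to an integer, then a
  trigonometric polynomial with frequencies in \<open>G\<close> that is concentrated on the Bohr set could not
  be orthogonal in mean to the character with frequency \<open>\<beta>\<close>.\<close>

lemma bohr_set_separates:
  fixes \<alpha> :: "nat \<Rightarrow> real"
  assumes G: "circle_subgroup G" and \<alpha>: "\<And>l. l < t \<Longrightarrow> \<alpha> l \<in> G" and \<beta>: "\<beta> \<notin> G" and "0 < \<epsilon>\<^sub>0"
  shows "\<exists>n\<ge>T. (\<forall>l<t. dist_int (real n * \<alpha> l) \<le> \<epsilon>\<^sub>0) \<and> 1/6 < dist_int (real n * \<beta>)"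
proof (rule ccontr)
  assume contra: "\<not> ?thesis"
  define \<epsilon> where "\<epsilon> = min \<epsilon>\<^sub>0 (1/4)"
  have \<epsilon>: "0 < \<epsilon>" "\<epsilon> \<le> 1/4" "\<epsilon> \<le> \<epsilon>\<^sub>0" using assms(4) by (auto simp: \<epsilon>_def)
  \<comment> \<open>Each factor lies in [0, 1] and equals 1 exactly when
    \<open>real n * \<alpha> l\<close> is an integer, so powers of the product concentrate on the
    Bohr set.\<close>
  define c where "c l n = (1 + cos (2 * pi * (real n * \<alpha> l))) / 2" for l n
  define f where "f n = (\<Prod>l<t. c l n)" for n
  have half01: "0 \<le> (1 + y) / 2" "(1 + y) / 2 \<le> 1" if "- 1 \<le> y" "y \<le> 1" for y :: real
    using that by auto
  from half01[OF cos_ge_minus_one cos_le_one] have c01: "0 \<le> c l n" "c l n \<le> 1" for l n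
    unfolding c_def by blast+
  have f01: "0 \<le> f n" "f n \<le> 1" for n unfolding f_def using c01 by (auto intro: prod_nonneg prod_le_1)
  \<comment> \<open>A bound for \<open>f\<close> off the Bohr set of radius
    \<open>\<epsilon>\<close>; the cap 1/4 on \<open>\<epsilon>\<close> keeps it positive.\<close>
  define \<eta> where "\<eta> = (1 + cos (2 * pi * \<epsilon>)) / 2"
  have "cos (2 * pi * (1/4)) \<le> cos (2 * pi * \<epsilon>)" using \<epsilon> by (intro cos_monotone_0_pi_le) auto
  moreover have "2 * pi * (1/4) = pi / 2" by simp
  ultimately have \<eta>0: "0 < \<eta>" by (simp add: \<eta>_def)
  have "cos (2 * pi * \<epsilon>) < cos 0" using \<epsilon> by (intro cos_monotone_0_pi) auto
  then have \<eta>1: "\<eta> < 1" by (simp add: \<eta>_def)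
  have outside: "f n \<le> \<eta>" if "l < t" "\<epsilon> < dist_int (real n * \<alpha> l)" for n l
  proof -
    have "f n = c l n * (\<Prod>l\<in>{..<t} - {l}. c l n)" using that(1) by (simp add: f_def prod.remove)
    also have "\<dots> \<le> c l n * 1" using c01 by (intro mult_left_mono prod_le_1) auto
    also have "\<dots> \<le> \<eta>" using cos_le_of_dist_int_ge[of \<epsilon> "real n * \<alpha> l"] that(2) \<epsilon> by (simp add: c_def \<eta>_def)
    finally show ?thesis .
  qed
  have "mean_orthogonal G (\<lambda>n. f n ^ K)" for K
  proof (induction K)
    case 0
    then show ?case using mean_orthogonal_1 G by (simp add: circle_subgroup_def)
  next
    case (Suc K)
    have "mean_orthogonal G (\<lambda>n. f n ^ K * (\<Prod>l<s. c l n))" if "s \<le> t" for s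
      using that
    proof (induction s)
      case 0
      then show ?case using Suc by simp
    next
      case (Suc s)
      from mean_orthogonal_mult_cos[OF G \<alpha>[of s], of "\<lambda>n. f n ^ K * (\<Prod>l<s. c l n)"] Suc
      show ?case by (simp add: c_def mult_ac)
    qed
    from this[of t] show ?case by (simp add: f_def mult.commute)
  qed
  then have orth: "(\<lambda>N. (\<Sum>n<N. of_real (f n ^ K) * cis (2 * pi * (real n * \<beta>))) / of_nat N) \<longlonglongrightarrow> 0" for K
    using \<beta> by (auto simp: mean_orthogonal_def)
  have lim: "(\<lambda>N. (\<Sum>n<N. f n ^ K * cos (2 * pi * (real n * \<beta>))) / real N) \<longlonglongrightarrow> 0" for K
  proof -
    have "(\<lambda>N. Re ((\<Sum>n<N. of_real (f n ^ K) * cis (2 * pi * (real n * \<beta>))) / of_nat N)) \<longlonglongrightarrow> Re 0"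
      by (intro tendsto_Re orth)
    moreover have "Re (of_real (f n ^ K) * cis x) = f n ^ K * cos x" for n x
      by simp
    ultimately show ?thesis by (simp add: Re_divide_of_nat del: of_real_power)
  qed
  \<comment> \<open>A smaller radius \<open>1 / q\<close> is chosen on which \<open>f\<close>
    exceeds \<open>\<eta>\<close>: the lower bound for \<open>f\<close> tends to 1 as the radius
    shrinks.\<close>
  have "(\<lambda>q. ((1 + cos (2 * pi * (1 / real q))) / 2) ^ t) \<longlonglongrightarrow> ((1 + cos (2 * pi * 0)) / 2) ^ t"
    by (intro tendsto_intros lim_1_over_n) simp
  then have "\<forall>\<^sub>F q in sequentially. \<eta> < ((1 + cos (2 * pi * (1 / real q))) / 2) ^ t"
    using \<eta>1 by (intro order_tendstoD(1)) auto
  then have "\<forall>\<^sub>F q in sequentially. \<eta> < ((1 + cos (2 * pi * (1 / real q))) / 2) ^ t \<and> 2 \<le> q"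
    using eventually_ge_at_top[of 2] by (rule eventually_conj)
  then obtain q :: nat where q: "\<eta> < ((1 + cos (2 * pi * (1 / real q))) / 2) ^ t" "2 \<le> q"
    using eventually_happens'[OF sequentially_bot] by blast
  define \<theta> where "\<theta> = ((1 + cos (2 * pi * (1 / real q))) / 2) ^ t"
  have inside: "\<theta> \<le> f n" if "\<forall>l<t. dist_int (real n * \<alpha> l) \<le> 1 / real q" for n
  proof -
    have "\<theta> = (\<Prod>l<t. (1 + cos (2 * pi * (1 / real q))) / 2)" by (simp add: \<theta>_def)
    also have "\<dots> \<le> f n" unfolding f_def
    proof (rule prod_mono)
      fix l assume "l \<in> {..<t}"
      then have "cos (2 * pi * (1 / real q)) \<le> cos (2 * pi * (real n * \<alpha> l))"
        using that q(2) by (intro cos_ge_of_dist_int_le) auto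
      then show "0 \<le> (1 + cos (2 * pi * (1 / real q))) / 2 \<and> (1 + cos (2 * pi * (1 / real q))) / 2 \<le> c l n"
        using half01(1)[OF cos_ge_minus_one cos_le_one] by (simp add: c_def)
    qed
    finally show ?thesis .
  qed
  \<comment> \<open>On the Bohr set a distance of at most 1/6 makes the cosine at least 1/2. Off it,
    \<open>f n ^ K\<close> is at most \<open>\<eta> ^ K\<close>, which pays for a cosine as low as
    -1. The constant 2 absorbs the indices below \<open>T\<close>.\<close>
  have pointwise: "f n ^ K / 2 - 3/2 * \<eta> ^ K - (if n < T then 2 else 0) \<le> f n ^ K * cos (2 * pi * (real n * \<beta>))" for n K
  proof -
    have fK: "0 \<le> f n ^ K" "f n ^ K \<le> 1" using f01 by (auto intro: power_le_one)
    have ge: "- (f n ^ K) \<le> f n ^ K * cos (2 * pi * (real n * \<beta>))"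
      using mult_left_mono[OF cos_ge_minus_one fK(1), of "2 * pi * (real n * \<beta>)"] by simp
    have \<eta>K: "0 \<le> \<eta> ^ K" using \<eta>0 by simp
    consider "n < T" | "T \<le> n" "\<exists>l<t. \<epsilon> < dist_int (real n * \<alpha> l)"
      | "T \<le> n" "\<forall>l<t. dist_int (real n * \<alpha> l) \<le> \<epsilon>" by force
    then show ?thesis
    proof cases
      case 1
      then show ?thesis using ge fK \<eta>K by simp
    next
      case 2
      then have "f n ^ K \<le> \<eta> ^ K" using outside f01 by (auto intro: power_mono)
      then show ?thesis using ge 2 by simp
    next
      case 3
      with contra \<epsilon> have "dist_int (real n * \<beta>) \<le> 1/6" by force
      from cos_ge_of_dist_int_le[OF this] have "1/2 \<le> cos (2 * pi * (real n * \<beta>))"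
        by (simp add: cos_60 field_simps)
      then have "f n ^ K * (1/2) \<le> f n ^ K * cos (2 * pi * (real n * \<beta>))"
        using fK by (intro mult_left_mono)
      then show ?thesis using 3 \<eta>K by simp
    qed
  qed
  \<comment> \<open>Average the pointwise bound over \<open>n < N\<close> and let \<open>N\<close>
    grow: the right side has mean tending to 0, while the density of the small Bohr set keeps the
    mean of \<open>f n ^ K\<close> at least \<open>\<theta> ^ K / real q ^ t\<close>. As
    \<open>\<theta>\<close> exceeds \<open>\<eta>\<close>, the result fails for large
    \<open>K\<close>.\<close>
  have "\<theta> ^ K \<le> 3 * real q ^ t * \<eta> ^ K" for K
  proof -
    define B where "B N = {n. n < N \<and> (\<forall>l<t. dist_int (real n * \<alpha> l) \<le> 1 / real q)}" for N
    have "\<theta> ^ K / (2 * real q ^ t) - 3/2 * \<eta> ^ K - 2 * real T / real N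
        \<le> (\<Sum>n<N. f n ^ K * cos (2 * pi * (real n * \<beta>))) / real N" if N: "0 < N" for N
    proof -
      have "real N \<le> real (card (B N) * q ^ t)"
        unfolding B_def of_nat_le_iff using q(2) by (intro bohr_set_density) auto
      then have "real N / real q ^ t \<le> real (card (B N))" using q(2) by (simp add: field_simps)
      then have "real N / real q ^ t * \<theta> ^ K \<le> real (card (B N)) * \<theta> ^ K"
        using q(1) \<eta>0 by (intro mult_right_mono) (auto simp: \<theta>_def)
      also have "\<dots> = (\<Sum>n\<in>B N. \<theta> ^ K)" by simp
      also have "\<dots> \<le> (\<Sum>n\<in>B N. f n ^ K)"
        using inside q(1) \<eta>0 by (intro sum_mono power_mono) (auto simp: B_def \<theta>_def)
      also have "\<dots> \<le> (\<Sum>n<N. f n ^ K)" using f01 by (intro sum_mono2) (auto simp: B_def)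
      finally have 1: "real N / real q ^ t * \<theta> ^ K \<le> (\<Sum>n<N. f n ^ K)" .
      have "(\<Sum>n<N. if n < T then 2 else 0 :: real) = (\<Sum>n\<in>{..<N} \<inter> {n. n < T}. 2)"
        by (subst sum.inter_restrict) auto
      also have "\<dots> \<le> (\<Sum>n<T. 2)" by (intro sum_mono2) auto
      finally have 2: "(\<Sum>n<N. if n < T then 2 else 0) \<le> 2 * real T" by simp
      have "(\<Sum>n<N. f n ^ K / 2 - 3/2 * \<eta> ^ K - (if n < T then 2 else 0)) \<le>
          (\<Sum>n<N. f n ^ K * cos (2 * pi * (real n * \<beta>)))"
        by (intro sum_mono pointwise)
      then have 3: "(\<Sum>n<N. f n ^ K) / 2 - real N * (3/2 * \<eta> ^ K) - (\<Sum>n<N. if n < T then 2 else 0) \<le>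
          (\<Sum>n<N. f n ^ K * cos (2 * pi * (real n * \<beta>)))"
        by (simp add: sum_subtractf sum_divide_distrib)
      have "real N / real q ^ t * \<theta> ^ K / 2 - real N * (3/2 * \<eta> ^ K) - 2 * real T \<le>
          (\<Sum>n<N. f n ^ K * cos (2 * pi * (real n * \<beta>)))"
        by (rule order_trans[OF _ 3]) (intro diff_mono divide_right_mono 1 2 order_refl zero_le_numeral)
      then have "(real N / real q ^ t * \<theta> ^ K / 2 - real N * (3/2 * \<eta> ^ K) - 2 * real T) / real N \<le>
          (\<Sum>n<N. f n ^ K * cos (2 * pi * (real n * \<beta>))) / real N" by (rule divide_right_mono) simp
      moreover have "(real N / real q ^ t * \<theta> ^ K / 2 - real N * (3/2 * \<eta> ^ K) - 2 * real T) / real N =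
          \<theta> ^ K / (2 * real q ^ t) - 3/2 * \<eta> ^ K - 2 * real T / real N"
        using N by (simp add: diff_divide_distrib)
      ultimately show ?thesis by simp
    qed
    then have ev: "\<forall>\<^sub>F N in sequentially. \<theta> ^ K / (2 * real q ^ t) - 3/2 * \<eta> ^ K - 2 * real T / real N
        \<le> (\<Sum>n<N. f n ^ K * cos (2 * pi * (real n * \<beta>))) / real N"
      using eventually_gt_at_top[of 0] by (rule eventually_mono[rotated])
    have "(\<lambda>N. \<theta> ^ K / (2 * real q ^ t) - 3/2 * \<eta> ^ K - 2 * real T / real N)
        \<longlonglongrightarrow> \<theta> ^ K / (2 * real q ^ t) - 3/2 * \<eta> ^ K - 0"
      by (intro tendsto_diff tendsto_const lim_const_over_n)
    from tendsto_le[OF _ lim this ev] have "\<theta> ^ K / (2 * real q ^ t) \<le> 3/2 * \<eta> ^ K" by simp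
    then show ?thesis using q(2) by (simp add: field_simps)
  qed
  then have "(\<theta> / \<eta>) ^ K \<le> 3 * real q ^ t" for K using \<eta>0 by (simp add: power_divide field_simps)
  moreover have "1 < \<theta> / \<eta>" using q(1) \<eta>0 by (simp add: \<theta>_def)
  then obtain K where "3 * real q ^ t < (\<theta> / \<eta>) ^ K" using real_arch_pow by blast
  ultimately show False by (meson not_le)
qed

section \<open>Gluing the stages\<close>

text \<open>The closed interval [0, 1], with both ends, represents the circle, so that compactness
  applies.\<close>

definition near_int_set :: "nat set \<Rightarrow> real set" where
  "near_int_set A = {\<beta>. 0 \<le> \<beta> \<and> \<beta> \<le> 1 \<and> (\<forall>n\<in>A. dist_int (real n * \<beta>) \<le> 1/6)}"

text \<open>Half of \<open>\<delta>\<close> pays for a cheap set scaled by \<open>T\<close>, which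
  moves it beyond \<open>t\<close> and leaves finitely many survivors. The other half pays for one
  extra element against each survivor outside \<open>G\<close>.\<close>

lemma stage_set:
  fixes \<alpha> :: "nat \<Rightarrow> real"
  assumes G: "circle_subgroup G" and \<alpha>: "\<And>i. \<alpha> i \<in> G" and r: "0 < r" and \<delta>: "0 < \<delta>"
  shows "\<exists>A. infinite A \<and> (\<forall>n\<in>A. t < n) \<and>
    (\<forall>i<t. \<forall>F. finite F \<longrightarrow> F \<subseteq> A \<longrightarrow> (\<Sum>n\<in>F. dist_int (real n * \<alpha> i) powr r) \<le> \<delta>) \<and>
    finite (near_int_set A) \<and> near_int_set A \<subseteq> G"
proof -
  define T where "T = Suc t"
  have T0: "0 < T" by (simp add: T_def)
  \<comment> \<open>The cheap set is built for the scaled frequencies, so that its elements times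
    \<open>T\<close> are cheap for the original ones.\<close>
  define \<alpha>' where "\<alpha>' l = real T * \<alpha> l" for l
  have "0 < \<delta> / 2" using \<delta> by simp
  from cheap_set_with_finite_zeros[OF r this, of \<alpha>' t] obtain A\<^sub>0 where A0: "infinite A\<^sub>0"
    "\<And>F. finite F \<Longrightarrow> F \<subseteq> A\<^sub>0 \<Longrightarrow> (\<Sum>u\<in>F. bohr_norm \<alpha>' t u powr r) \<le> \<delta> / 2"
    "\<And>X. finite {\<beta>. 0 \<le> \<beta> \<and> \<beta> \<le> X \<and> (\<forall>n\<in>A\<^sub>0. dist_int (of_int n * \<beta>) \<le> 1/6)}"
    by blast
  define g where "g n = T * nat \<bar>n\<bar>" for n :: int
  have g: "dist_int (real (g n) * x) = dist_int (of_int n * (real T * x))" for n x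
    using dist_int_mult_abs[of n "real T * x"] by (simp add: g_def mult_ac)
  define A\<^sub>1 where "A\<^sub>1 = g ` (A\<^sub>0 - {0})"
  have inf: "infinite A\<^sub>1"
  proof
    assume fin: "finite A\<^sub>1"
    have "A\<^sub>0 - {0} \<subseteq> {- int (Max A\<^sub>1)..int (Max A\<^sub>1)}"
    proof
      fix n assume "n \<in> A\<^sub>0 - {0}"
      then have "g n \<le> Max A\<^sub>1" using fin by (simp add: A\<^sub>1_def)
      moreover have "nat \<bar>n\<bar> \<le> g n" using T0 by (simp add: g_def)
      ultimately show "n \<in> {- int (Max A\<^sub>1)..int (Max A\<^sub>1)}" by auto
    qed
    then have "finite (A\<^sub>0 - {0})" using finite_subset by blast
    with A0(1) show False by simp
  qed
  have gt1: "t < n" if "n \<in> A\<^sub>1" for n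
  proof -
    from that obtain m where m: "n = T * nat \<bar>m\<bar>" "m \<noteq> 0" by (auto simp: A\<^sub>1_def g_def)
    then have "T * 1 \<le> n" unfolding m(1) by (intro mult_le_mono2) linarith
    then show ?thesis by (simp add: T_def)
  qed
  have sum1: "(\<Sum>n\<in>F. dist_int (real n * \<alpha> i) powr r) \<le> \<delta> / 2"
    if "i < t" "finite F" "F \<subseteq> A\<^sub>1" for i F
  proof -
    \<comment> \<open>\<open>g\<close> identifies \<open>n\<close> and \<open>- n\<close>, so each
      element of \<open>F\<close> gets one chosen preimage.\<close>
    from that(3) obtain U where U: "U \<subseteq> A\<^sub>0 - {0}" "inj_on g U" "F = g ` U"
      unfolding A\<^sub>1_def subset_image_inj by blast
    have finU: "finite U" using U(2,3) that(2) by (simp add: finite_image_iff)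
    have "(\<Sum>n\<in>F. dist_int (real n * \<alpha> i) powr r) = (\<Sum>u\<in>U. dist_int (of_int u * \<alpha>' i) powr r)"
      using U by (simp add: sum.reindex g \<alpha>'_def)
    also have "\<dots> \<le> (\<Sum>u\<in>U. bohr_norm \<alpha>' t u powr r)"
    proof (intro sum_mono powr_mono2)
      fix u
      show "dist_int (of_int u * \<alpha>' i) \<le> bohr_norm \<alpha>' t u"
        unfolding bohr_norm_def using that(1)
        by (intro member_le_sum[of i "{..<t}" "\<lambda>l. dist_int (of_int u * \<alpha>' l)"]) auto
    qed (use r in auto)
    also have "\<dots> \<le> \<delta> / 2" using U(1) finU by (intro A0(2)) auto
    finally show ?thesis .
  qed
  have fin1: "finite (near_int_set A\<^sub>1)"
  proof -
    \<comment> \<open>Scaling by \<open>T\<close> carries [0, 1] onto [0, T]; finiteness is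
      available there since it was proved for every bound.\<close>
    let ?Z = "{\<beta>. 0 \<le> \<beta> \<and> \<beta> \<le> real T \<and> (\<forall>n\<in>A\<^sub>0. dist_int (of_int n * \<beta>) \<le> 1/6)}"
    have "(\<lambda>\<beta>. real T * \<beta>) ` near_int_set A\<^sub>1 \<subseteq> ?Z"
    proof (intro image_subsetI CollectI conjI ballI)
      fix \<beta> assume \<beta>: "\<beta> \<in> near_int_set A\<^sub>1"
      then show "0 \<le> real T * \<beta>" "real T * \<beta> \<le> real T" using T0 by (auto simp: near_int_set_def)
      fix n assume n: "n \<in> A\<^sub>0"
      show "dist_int (of_int n * (real T * \<beta>)) \<le> 1/6"
      proof (cases "n = 0")
        case False
        then have "g n \<in> A\<^sub>1" using n by (simp add: A\<^sub>1_def)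
        then show ?thesis using \<beta> unfolding near_int_set_def g[symmetric] by blast
      qed simp
    qed
    then have "finite ((\<lambda>\<beta>. real T * \<beta>) ` near_int_set A\<^sub>1)" using A0(3) finite_subset by blast
    then show ?thesis using T0 by (subst (asm) finite_image_iff) (auto simp: inj_on_def)
  qed
  define Bad where "Bad = near_int_set A\<^sub>1 - G"
  have finBad: "finite Bad" using fin1 by (simp add: Bad_def)
  \<comment> \<open>The share of \<open>\<delta> / 2\<close> for each extra element;
    \<open>Suc\<close> avoids a division by zero when \<open>Bad\<close> is empty.\<close>
  define \<theta> where "\<theta> = \<delta> / (2 * real (Suc (card Bad)))"
  have \<theta>: "0 < \<theta>" using \<delta> by (simp add: \<theta>_def)
  define \<epsilon> where "\<epsilon> = \<theta> powr (1/r)"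
  have \<epsilon>: "0 < \<epsilon>" "\<epsilon> powr r = \<theta>" using \<theta> r by (simp_all add: \<epsilon>_def powr_powr)
  have "\<exists>n\<ge>T. (\<forall>l<t. dist_int (real n * \<alpha> l) \<le> \<epsilon>) \<and> 1/6 < dist_int (real n * \<beta>)" if "\<beta> \<in> Bad" for \<beta>
    using that by (intro bohr_set_separates[OF G \<alpha> _ \<epsilon>(1)]) (auto simp: Bad_def)
  then obtain N where N: "\<And>\<beta>. \<beta> \<in> Bad \<Longrightarrow> T \<le> N \<beta>"
    "\<And>\<beta> l. \<beta> \<in> Bad \<Longrightarrow> l < t \<Longrightarrow> dist_int (real (N \<beta>) * \<alpha> l) \<le> \<epsilon>"
    "\<And>\<beta>. \<beta> \<in> Bad \<Longrightarrow> 1/6 < dist_int (real (N \<beta>) * \<beta>)"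
    by metis
  define A where "A = A\<^sub>1 \<union> N ` Bad"
  have sub: "near_int_set A \<subseteq> near_int_set A\<^sub>1" by (auto simp: near_int_set_def A_def)
  have "near_int_set A \<subseteq> G"
  proof
    fix \<beta> assume \<beta>: "\<beta> \<in> near_int_set A"
    show "\<beta> \<in> G"
    proof (rule ccontr)
      assume "\<beta> \<notin> G"
      with \<beta> sub have bad: "\<beta> \<in> Bad" by (auto simp: Bad_def)
      then have "dist_int (real (N \<beta>) * \<beta>) \<le> 1/6" using \<beta> unfolding near_int_set_def A_def by blast
      with N(3)[OF bad] show False by simp
    qed
  qed
  moreover have "(\<Sum>n\<in>F. dist_int (real n * \<alpha> i) powr r) \<le> \<delta>"
    if "i < t" "finite F" "F \<subseteq> A" for i F
  proof -
    have "(\<Sum>n\<in>F. dist_int (real n * \<alpha> i) powr r) =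
        (\<Sum>n\<in>F \<inter> A\<^sub>1. dist_int (real n * \<alpha> i) powr r) + (\<Sum>n\<in>F - A\<^sub>1. dist_int (real n * \<alpha> i) powr r)"
      using that(2) by (rule sum.Int_Diff)
    also have "(\<Sum>n\<in>F \<inter> A\<^sub>1. dist_int (real n * \<alpha> i) powr r) \<le> \<delta> / 2"
      using that by (intro sum1) auto
    also have "(\<Sum>n\<in>F - A\<^sub>1. dist_int (real n * \<alpha> i) powr r) \<le> (\<Sum>n\<in>F - A\<^sub>1. \<theta>)"
    proof (rule sum_mono)
      fix n assume "n \<in> F - A\<^sub>1"
      with that(3) obtain \<beta> where "\<beta> \<in> Bad" "n = N \<beta>" by (auto simp: A_def)
      then have "dist_int (real n * \<alpha> i) powr r \<le> \<epsilon> powr r"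
        using N(2) that(1) r by (intro powr_mono2) auto
      then show "dist_int (real n * \<alpha> i) powr r \<le> \<theta>" by (simp add: \<epsilon>)
    qed
    also have "\<dots> = real (card (F - A\<^sub>1)) * \<theta>" by simp
    also have "\<dots> \<le> real (Suc (card Bad)) * \<theta>"
    proof -
      have "card (F - A\<^sub>1) \<le> card (N ` Bad)" using that finBad by (intro card_mono) (auto simp: A_def)
      also have "\<dots> \<le> card Bad" by (rule card_image_le[OF finBad])
      finally show ?thesis using \<theta> by (intro mult_right_mono) auto
    qed
    also have "\<dots> = \<delta> / 2" by (simp add: \<theta>_def del: of_nat_Suc)
    finally show ?thesis by simp
  qed
  moreover have "\<forall>n\<in>A. t < n" using gt1 N(1) by (force simp: A_def T_def)
  moreover have "finite (near_int_set A)" using sub fin1 finite_subset by blast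
  ultimately show ?thesis using inf by (intro exI[of _ A]) (auto simp: A_def)
qed

text \<open>Compactness: if no \<open>N\<close> worked, the counterexamples would have a limit
  point, which by continuity lies in \<open>near_int_set A\<close>, although they stay at distance
  at least \<open>\<eta>\<close> from that set.\<close>

lemma near_int_set_truncation:
  assumes "0 < \<eta>"
  shows "\<exists>N. \<forall>\<beta>. 0 \<le> \<beta> \<longrightarrow> \<beta> \<le> 1 \<longrightarrow> (\<forall>n\<in>A. n \<le> N \<longrightarrow> dist_int (real n * \<beta>) \<le> 1/6) \<longrightarrow>
    (\<exists>x\<in>near_int_set A. \<bar>\<beta> - x\<bar> < \<eta>)"
proof (rule ccontr)
  assume "\<not> ?thesis"
  then have "\<forall>N. \<exists>\<beta>. 0 \<le> \<beta> \<and> \<beta> \<le> 1 \<and> (\<forall>n\<in>A. n \<le> N \<longrightarrow> dist_int (real n * \<beta>) \<le> 1/6) \<and>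
    (\<forall>x\<in>near_int_set A. \<eta> \<le> \<bar>\<beta> - x\<bar>)" by (simp add: not_less)
  then obtain b where b: "\<And>N. 0 \<le> b N" "\<And>N. b N \<le> 1"
    "\<And>N n. n \<in> A \<Longrightarrow> n \<le> N \<Longrightarrow> dist_int (real n * b N) \<le> 1/6"
    "\<And>N x. x \<in> near_int_set A \<Longrightarrow> \<eta> \<le> \<bar>b N - x\<bar>" by metis
  have "seq_compact {0..1::real}" by (intro compact_imp_seq_compact compact_Icc)
  then obtain x \<sigma> where x: "x \<in> {0..1}" "strict_mono \<sigma>" "(b \<circ> \<sigma>) \<longlonglongrightarrow> x"
    by (rule seq_compactE[where f = b]) (use b in auto)
  have "dist_int (real n * x) \<le> 1/6" if n: "n \<in> A" for n
  proof (rule tendsto_upperbound)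
    have "isCont dist_int (real n * x)"
      using continuous_on_dist_int[of UNIV] by (simp add: continuous_on_eq_continuous_at)
    then show "(\<lambda>k. dist_int (real n * (b \<circ> \<sigma>) k)) \<longlonglongrightarrow> dist_int (real n * x)"
      by (rule isCont_tendsto_compose) (intro tendsto_intros x)
    show "\<forall>\<^sub>F k in sequentially. dist_int (real n * (b \<circ> \<sigma>) k) \<le> 1/6"
      using eventually_ge_at_top[of n]
    proof eventually_elim
      case (elim k)
      then show ?case using b(3)[OF n, of "\<sigma> k"] strict_mono_imp_increasing[OF x(2), of k] by simp
    qed
  qed simp
  with x(1) have "x \<in> near_int_set A" by (auto simp: near_int_set_def)
  moreover have "\<forall>\<^sub>F k in sequentially. \<bar>(b \<circ> \<sigma>) k - x\<bar> < \<eta>"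
    using x(3) assms unfolding tendsto_iff dist_real_def by blast
  then obtain k where "\<bar>(b \<circ> \<sigma>) k - x\<bar> < \<eta>"
    using eventually_happens'[OF sequentially_bot] by blast
  ultimately show False using b(4)[of x "\<sigma> k"] by simp
qed

lemma finite_set_separation:
  fixes S :: "real set"
  assumes "finite S"
  shows "\<exists>s>0. \<forall>x\<in>S. \<forall>y\<in>S. x \<noteq> y \<longrightarrow> s \<le> \<bar>x - y\<bar>"
proof -
  \<comment> \<open>The element 1 provides a separation also when there are no two distinct
    points.\<close>
  define D where "D = insert 1 ((\<lambda>(x, y). \<bar>x - y\<bar>) ` (S \<times> S) - {0})"
  have "finite D" using assms by (simp add: D_def)
  moreover have "0 < d" if "d \<in> D" for d using that by (auto simp: D_def)
  moreover have "\<bar>x - y\<bar> \<in> D" if "x \<in> S" "y \<in> S" "x \<noteq> y" for x y using that by (force simp: D_def)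
  moreover have "D \<noteq> {}" by (simp add: D_def)
  ultimately show ?thesis by (intro exI[of _ "Min D"]) auto
qed

text \<open>The sets may overlap; peeling off \<open>B K\<close> assigns each element to the last
  set containing it.\<close>

lemma sum_le_sum_of_cover:
  fixes g :: "nat \<Rightarrow> real" and K :: nat
  assumes "finite F" "F \<subseteq> (\<Union>t<K. B t)" "\<And>n. 0 \<le> g n"
    and "\<And>t F. finite F \<Longrightarrow> F \<subseteq> B t \<Longrightarrow> (\<Sum>n\<in>F. g n) \<le> b t"
  shows "(\<Sum>n\<in>F. g n) \<le> (\<Sum>t<K. b t)"
  using assms(1,2)
proof (induction K arbitrary: F)
  case (Suc K)
  have "(\<Sum>n\<in>F. g n) = (\<Sum>n\<in>F \<inter> B K. g n) + (\<Sum>n\<in>F - B K. g n)"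
    using Suc.prems(1) by (rule sum.Int_Diff)
  also have "(\<Sum>n\<in>F \<inter> B K. g n) \<le> b K" using Suc.prems(1) by (intro assms(4)) auto
  also have "(\<Sum>n\<in>F - B K. g n) \<le> (\<Sum>t<K. b t)"
    using Suc.prems by (intro Suc.IH) (auto simp: lessThan_Suc)
  finally show ?case by simp
qed simp

theorem theorem1:
  fixes G :: "real set"
  assumes "circle_subgroup G" and "countable G"
  shows "\<exists>a :: nat \<Rightarrow> nat. strict_mono a \<and> a 0 > 0 \<and>
           (\<forall>\<beta>::real. (\<beta> \<in> G \<longrightarrow> (\<forall>r::real. r > 0 \<longrightarrow> summable (\<lambda>k. dist_int (real (a k) * \<beta>) powr r)))
                    \<and> (\<beta> \<notin> G \<longrightarrow> limsup (\<lambda>k. ereal (dist_int (real (a k) * \<beta>))) \<ge> ereal (1/6)))"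
proof -
  have IntsG: "\<int> \<subseteq> G" using assms(1) by (simp add: circle_subgroup_def)
  then have "G \<noteq> {}" by auto
  define \<alpha> where "\<alpha> = from_nat_into G"
  have ran: "range \<alpha> = G" using \<open>G \<noteq> {}\<close> assms(2) by (simp add: \<alpha>_def)
  then have \<alpha>: "\<alpha> i \<in> G" for i by auto
  \<comment> \<open>The exponent \<open>1 / real (Suc t)\<close> eventually drops below any given
    \<open>r\<close>, and smaller exponents give larger terms because distances are at most 1. The
    budgets \<open>(1/2) ^ t\<close> are summable.\<close>
  have "\<exists>A. infinite A \<and> (\<forall>n\<in>A. t < n) \<and>
    (\<forall>i<t. \<forall>F. finite F \<longrightarrow> F \<subseteq> A \<longrightarrow> (\<Sum>n\<in>F. dist_int (real n * \<alpha> i) powr (1 / real (Suc t))) \<le> (1/2) ^ t) \<and>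
    finite (near_int_set A) \<and> near_int_set A \<subseteq> G" for t
    by (rule stage_set[OF assms(1) \<alpha>]) auto
  then obtain A where A: "\<And>t. infinite (A t)" "\<And>t n. n \<in> A t \<Longrightarrow> t < n"
    "\<And>t i F. i < t \<Longrightarrow> finite F \<Longrightarrow> F \<subseteq> A t \<Longrightarrow>
        (\<Sum>n\<in>F. dist_int (real n * \<alpha> i) powr (1 / real (Suc t))) \<le> (1/2) ^ t"
    "\<And>t. finite (near_int_set (A t))" "\<And>t. near_int_set (A t) \<subseteq> G"
    by metis
  define Z where "Z t = near_int_set (A t)" for t
  have "\<exists>s>0. \<forall>x\<in>Z t \<union> Z (Suc t). \<forall>y\<in>Z t \<union> Z (Suc t). x \<noteq> y \<longrightarrow> s \<le> \<bar>x - y\<bar>" for t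
    using A(4) by (intro finite_set_separation) (auto simp: Z_def)
  then obtain s where s: "\<And>t. 0 < s t"
    "\<And>t x y. x \<in> Z t \<union> Z (Suc t) \<Longrightarrow> y \<in> Z t \<union> Z (Suc t) \<Longrightarrow> x \<noteq> y \<Longrightarrow> s t \<le> \<bar>x - y\<bar>"
    by metis
  \<comment> \<open>The minimum includes all \<open>s i\<close> with \<open>i \<le> t\<close>,
    because comparing stages \<open>t\<close> and \<open>Suc t\<close> needs both radii to be at
    most \<open>s t / 2\<close>. The term \<open>1 / real (Suc t)\<close> makes the radii tend to
    0.\<close>
  define \<eta> where "\<eta> t = Min (insert (1 / real (Suc t)) (s ` {..t})) / 2" for t
  have \<eta>0: "0 < \<eta> t" for t using s(1) by (simp add: \<eta>_def)
  have \<eta>1: "\<eta> t \<le> 1 / real (Suc t)" for t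
  proof -
    have "Min (insert (1 / real (Suc t)) (s ` {..t})) \<le> 1 / real (Suc t)" by (intro Min_le) auto
    then show ?thesis using \<eta>0[of t] unfolding \<eta>_def by linarith
  qed
  have \<eta>s: "\<eta> u \<le> s t / 2" if "t \<le> u" for t u
    unfolding \<eta>_def using that by (intro divide_right_mono Min_le) auto
  have "\<exists>N. \<forall>\<beta>. 0 \<le> \<beta> \<longrightarrow> \<beta> \<le> 1 \<longrightarrow> (\<forall>n\<in>A t. n \<le> N \<longrightarrow> dist_int (real n * \<beta>) \<le> 1/6) \<longrightarrow>
    (\<exists>x\<in>Z t. \<bar>\<beta> - x\<bar> < \<eta> t)" for t
    unfolding Z_def by (rule near_int_set_truncation[OF \<eta>0])
  then obtain N where N: "\<And>t \<beta>. 0 \<le> \<beta> \<Longrightarrow> \<beta> \<le> 1 \<Longrightarrow>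
      (\<And>n. n \<in> A t \<Longrightarrow> n \<le> N t \<Longrightarrow> dist_int (real n * \<beta>) \<le> 1/6) \<Longrightarrow> \<exists>x\<in>Z t. \<bar>\<beta> - x\<bar> < \<eta> t"
    by metis
  have "\<exists>m. m \<in> A t" for t using A(1)[of t] by (metis ex_in_conv finite.emptyI)
  then obtain m where m: "\<And>t. m t \<in> A t" by metis
  \<comment> \<open>Including \<open>m t\<close> keeps every \<open>B t\<close> nonempty, so that
    the union is infinite although each stage is finite.\<close>
  define B where "B t = {n \<in> A t. n \<le> max (N t) (m t)}" for t
  have finB: "finite (B t)" for t by (rule finite_subset[of _ "{..max (N t) (m t)}"]) (auto simp: B_def)
  define S where "S = (\<Union>t. B t)"
  have infS: "infinite S"
    unfolding infinite_nat_iff_unbounded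
  proof
    fix t
    have "m t \<in> S" using m by (auto simp: S_def B_def intro!: exI[of _ t])
    then show "\<exists>n>t. n \<in> S" using A(2)[OF m] by blast
  qed
  define a where "a = enumerate S"
  have mono: "strict_mono a" unfolding a_def by (rule strict_mono_enumerate[OF infS])
  have aS: "a k \<in> S" for k unfolding a_def by (rule enumerate_in_set[OF infS])
  have ranS: "range a = S" unfolding a_def by (rule range_enumerate[OF infS])
  have "a 0 > 0" using aS[of 0] A(2) by (force simp: S_def B_def)
  moreover have "summable (\<lambda>k. dist_int (real (a k) * \<beta>) powr r)" if "\<beta> \<in> G" "r > 0" for \<beta> r
  proof -
    obtain i where i: "\<beta> = \<alpha> i" using \<open>\<beta> \<in> G\<close> ran by blast
    \<comment> \<open>From stage \<open>t\<^sub>0\<close> on, both \<open>i < t\<close> and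
      \<open>1 / real (Suc t) \<le> r\<close> hold.\<close>
    obtain t\<^sub>0 :: nat where t0: "1 / r + real i < real t\<^sub>0" using reals_Archimedean2 by blast
    define g where "g n = dist_int (real n * \<beta>) powr r" for n
    have g1: "g n \<le> 1" for n
    proof -
      have "dist_int (real n * \<beta>) powr r \<le> 1 powr r"
        using that(2) dist_int_le_half[of "real n * \<beta>"] by (intro powr_mono2) auto
      then show ?thesis by (simp add: g_def)
    qed
    \<comment> \<open>The finitely many earlier stages are bounded by their cardinalities, since
      each term is at most 1.\<close>
    define b where "b t = (if t < t\<^sub>0 then real (card (B t)) else 0) + (1/2) ^ t" for t
    have b: "(\<Sum>n\<in>F. g n) \<le> b t" if F: "finite F" "F \<subseteq> B t" for t F
    proof (cases "t < t\<^sub>0")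
      case True
      have "(\<Sum>n\<in>F. g n) \<le> (\<Sum>n\<in>F. 1)" by (intro sum_mono g1)
      also have "\<dots> \<le> real (card (B t))" using F card_mono[OF finB] by simp
      finally show ?thesis using True by (simp add: b_def add_increasing2)
    next
      case False
      have "0 < 1 / r" using \<open>r > 0\<close> by simp
      with t0 False have it: "i < t" "1 / r \<le> real (Suc t)" by linarith+
      then have rt: "1 / real (Suc t) \<le> r" using \<open>r > 0\<close> by (simp add: field_simps)
      have "(\<Sum>n\<in>F. g n) \<le> (\<Sum>n\<in>F. dist_int (real n * \<alpha> i) powr (1 / real (Suc t)))"
      proof (rule sum_mono)
        fix n
        show "g n \<le> dist_int (real n * \<alpha> i) powr (1 / real (Suc t))"
          unfolding g_def i using dist_int_le_half[of "real n * \<alpha> i"] rt by (intro powr_mono') auto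
      qed
      also have "\<dots> \<le> (1/2) ^ t" using F by (intro A(3)[OF it(1)]) (auto simp: B_def)
      finally show ?thesis using False by (simp add: b_def)
    qed
    have "summable b"
      unfolding b_def by (intro summable_add summable_geometric summable_finite[of "{..<t\<^sub>0}"]) auto
    have b0: "0 \<le> b t" for t by (simp add: b_def)
    have "summable (\<lambda>k. g (a k))"
    proof (rule summableI_nonneg_bounded)
      fix k
      have inj: "inj_on a {..<k}" using mono by (meson inj_on_subset strict_mono_imp_inj_on subset_UNIV)
      have "\<exists>K. a ` {..<k} \<subseteq> (\<Union>t<K. B t)"
      proof (induction k)
        case (Suc k)
        then obtain K where K: "a ` {..<k} \<subseteq> (\<Union>t<K. B t)" by blast
        obtain u where u: "a k \<in> B u" using aS[of k] by (auto simp: S_def)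
        have "(\<Union>t<K. B t) \<subseteq> (\<Union>t<max K (Suc u). B t)" by (intro UN_mono) auto
        with K u show ?case by (intro exI[of _ "max K (Suc u)"]) (auto simp: lessThan_Suc)
      qed simp
      then obtain K where K: "a ` {..<k} \<subseteq> (\<Union>t<K. B t)" by blast
      have "(\<Sum>j<k. g (a j)) = (\<Sum>n\<in>a ` {..<k}. g n)" by (simp add: sum.reindex[OF inj])
      also have "\<dots> \<le> (\<Sum>t<K. b t)"
        using K b by (intro sum_le_sum_of_cover[where B = B]) (auto simp: g_def)
      also have "\<dots> \<le> suminf b" using \<open>summable b\<close> b0 by (intro sum_le_suminf) auto
      finally show "(\<Sum>j<k. g (a j)) \<le> suminf b" .
    qed (simp add: g_def)
    then show ?thesis by (simp add: g_def)
  qed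
  moreover have "limsup (\<lambda>k. ereal (dist_int (real (a k) * \<beta>))) \<ge> ereal (1/6)" if "\<beta> \<notin> G" for \<beta>
  proof (rule ccontr)
    assume "\<not> ?thesis"
    then have "limsup (\<lambda>k. ereal (dist_int (real (a k) * \<beta>))) < ereal (1/6)" by simp
    from Limsup_lessD[OF this] obtain k\<^sub>0 where
      k0: "\<And>k. k \<ge> k\<^sub>0 \<Longrightarrow> dist_int (real (a k) * \<beta>) < 1/6"
      by (auto simp: eventually_sequentially)
    define \<gamma> where "\<gamma> = frac \<beta>"
    have \<gamma>: "0 \<le> \<gamma>" "\<gamma> \<le> 1" using frac_lt_1[of \<beta>] by (simp_all add: \<gamma>_def less_imp_le)
    have dist: "dist_int (real n * \<gamma>) = dist_int (real n * \<beta>)" for n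
    proof -
      have "real n * \<beta> = real n * \<gamma> + of_int (int n * \<lfloor>\<beta>\<rfloor>)" by (simp add: \<gamma>_def frac_def algebra_simps)
      then show ?thesis by (metis dist_int_add_of_int)
    qed
    \<comment> \<open>Elements of \<open>A t\<close> exceed \<open>t\<close>, hence
      \<open>a k\<^sub>0\<close>, and so occur late enough in \<open>a\<close> for the bound from
      the limsup to apply.\<close>
    have "\<exists>x\<in>Z t. \<bar>\<gamma> - x\<bar> < \<eta> t" if t: "a k\<^sub>0 \<le> t" for t
    proof (rule N[OF \<gamma>])
      fix n assume n: "n \<in> A t" "n \<le> N t"
      then have "n \<in> S" by (auto simp: S_def B_def)
      then obtain k where k: "n = a k" using ranS by auto
      have "a k\<^sub>0 < a k" using A(2)[OF n(1)] t k by simp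
      then have "k\<^sub>0 \<le> k" using mono by (simp add: strict_mono_less less_imp_le)
      then show "dist_int (real n * \<gamma>) \<le> 1/6" using k0[of k] by (simp add: dist k)
    qed
    then obtain x where x: "\<And>t. a k\<^sub>0 \<le> t \<Longrightarrow> x t \<in> Z t" "\<And>t. a k\<^sub>0 \<le> t \<Longrightarrow> \<bar>\<gamma> - x t\<bar> < \<eta> t"
      by metis
    \<comment> \<open>The two radii add up to at most \<open>s t\<close>, so distinct survivors of
      consecutive stages cannot both be this close to \<open>\<gamma>\<close>.\<close>
    have step: "x (Suc t) = x t" if t: "a k\<^sub>0 \<le> t" for t
    proof (rule ccontr)
      assume "x (Suc t) \<noteq> x t"
      then have "s t \<le> \<bar>x (Suc t) - x t\<bar>" using x(1) t by (intro s(2)) auto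
      moreover have "\<bar>\<gamma> - x t\<bar> < \<eta> t" "\<bar>\<gamma> - x (Suc t)\<bar> < \<eta> (Suc t)" using x(2) t by auto
      ultimately show False using \<eta>s[of t t] \<eta>s[of t "Suc t"] by linarith
    qed
    have const: "x (a k\<^sub>0 + d) = x (a k\<^sub>0)" for d by (induction d) (use step in auto)
    \<comment> \<open>The survivor is the same at all later stages, and its distance to
      \<open>\<gamma>\<close> is below radii that tend to 0.\<close>
    have "\<gamma> = x (a k\<^sub>0)"
    proof (rule ccontr)
      assume "\<gamma> \<noteq> x (a k\<^sub>0)"
      then obtain d where d: "inverse (real (Suc d)) < \<bar>\<gamma> - x (a k\<^sub>0)\<bar>"
        using reals_Archimedean[of "\<bar>\<gamma> - x (a k\<^sub>0)\<bar>"] by auto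
      have "\<bar>\<gamma> - x (a k\<^sub>0)\<bar> < \<eta> (a k\<^sub>0 + d)" using x(2)[of "a k\<^sub>0 + d"] const by simp
      also have "\<dots> \<le> 1 / real (Suc (a k\<^sub>0 + d))" by (rule \<eta>1)
      also have "\<dots> \<le> 1 / real (Suc d)" by (intro divide_left_mono) auto
      finally show False using d by (simp add: inverse_eq_divide)
    qed
    then have "\<gamma> \<in> G" using x(1)[of "a k\<^sub>0"] A(5) by (auto simp: Z_def)
    \<comment> \<open>\<open>G\<close> contains the integers, so membership passes from the
      fractional part back to \<open>\<beta>\<close>.\<close>
    moreover have "of_int (- \<lfloor>\<beta>\<rfloor>) \<in> G" using IntsG Ints_of_int by blast
    ultimately have "\<gamma> - of_int (- \<lfloor>\<beta>\<rfloor>) \<in> G" using assms(1) unfolding circle_subgroup_def by blast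
    then show False using that by (simp add: \<gamma>_def frac_def)
  qed
  ultimately show ?thesis using mono by blast
qed

end
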